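(* Let $\Gamma$ be a (connected, finite type) Dynkin diagram, $Q$ a $\Gamma$ quiver with vertex set $I$, and $W(Q)$ the corresponding Weyl group generated by the set $S=\{s_i : i\in I\}$ of simple reflections. Let $\alpha\in\mathrm{Aut}(W(Q))$. Then $\alpha$ is an inner by diagram automorphism of $W(Q)$ if and only if there exists a finite sequence of mutations preserving the underlying diagram $\Gamma$ such that $\alpha(S)$ is obtained from $Q$ by these mutations; that is, the sequence of mutations, starting from $Q$ with the elements $(s_i)_{i\in I}$ attached to its vertices, ends at a quiver with underlying diagram $\Gamma$ whose set of attached elements is $\alpha(S)$. In particular, every reflection in $W(Q)$ occurs as an element attached to a vertex of a quiver obtained from $Q$ by a sequence of mutations.
   Context: Quivers are finite, without loops or oriented 2-cycles, with positive integer weights on arrows, coming from skew-symmetrizable integer matrices $(b_{ij})$ (arrow $i\to j$ of weight $|b_{ij}b_{ji}|$ when $b_{ij}>0$). A $\Gamma$ quiver is a quiver whose underlying unoriented weighted diagram is the Dynkin diagram $\Gamma$ (edges have weight $1$, $2$ or $3$ according as they are simple, double or triple). Mutation $\mu_k(Q)$ at a vertex $k$: (i) reverse all arrows incident to $k$, keeping weights; (ii) for each oriented path $i\to k\to j$ with weights $a,b$, the weight $c$ of the edge between $i,j$ in $Q$ and the weight $c'$ of that edge in $\mu_k(Q)$ satisfy $\pm\sqrt c\pm\sqrt{c'}=\sqrt{ab}$, the sign of $\sqrt c$ (resp. $\sqrt{c'}$) being $+$ if $i,j,k$ form an oriented cycle in $Q$ (resp. $\mu_k(Q)$) and $-$ otherwise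 (weight $0$ means no edge); (iii) all other edges are unchanged. $W(Q)$ is the group generated by $s_i$ ($i\in I$) with $s_i^2=e$ and $(s_is_j)^{m_{ij}}=e$ for $i\neq j$, where $m_{ij}=2,3,4,6$ if $i,j$ are respectively not joined, or joined by an edge of weight $1,2,3$; it is the Weyl group of $\Gamma$. Its reflections are the elements $wsw^{-1}$, $w\in W(Q)$, $s\in S$. Mutation of attached elements: if a quiver has elements $x_i\in W(Q)$ attached to its vertices, then after mutation at $k$ the attached elements are $x_i'=x_kx_ix_k$ if there is an arrow $i\to k$ (of any weight) in the quiver before mutation, and $x_i'=x_i$ otherwise. A diagram automorphism of $W(Q)$ is an automorphism induced by a permutation of $S$ that is an automorphism of the Coxeter diagram (i.e. preserves the $m_{ij}$). An inner by diagram automorphism is an element of the subgroup of $\mathrm{Aut}(W(Q))$ generated by inner automorphisms and diagram automorphisms (equivalently a product of an inner and a diagram automorphism). A sequence of mutations is said to preserve the underlying diagram if its final quiver has the same underlying diagram, up to relabelling of vertices, as the initial one. *)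

theory Defs
  imports Complex_Main "HOL-Algebra.Bij" "HOL-Algebra.Generated_Groups"
begin

section \<open>Quivers and their mutation\<close>

text \<open>A quiver on the vertex set \<open>UNIV :: 'v set\<close>: \<open>Q i j\<close> is the weight of the arrow from
  \<open>i\<close> to \<open>j\<close>, and \<open>0\<close> if there is no such arrow.\<close>

type_synonym 'v quiver = "'v \<Rightarrow> 'v \<Rightarrow> nat"

definition skew_symmetrizable :: "('v \<Rightarrow> 'v \<Rightarrow> int) \<Rightarrow> bool" where
  "skew_symmetrizable b \<longleftrightarrow>
     (\<exists>d :: 'v \<Rightarrow> int. (\<forall>i. d i > 0) \<and> (\<forall>i j. d i * b i j = - (d j * b j i)))"

definition quiver_of_matrix :: "('v \<Rightarrow> 'v \<Rightarrow> int) \<Rightarrow> 'v quiver" where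
  "quiver_of_matrix b = (\<lambda>i j. if b i j > 0 then nat \<bar>b i j * b j i\<bar> else 0)"

definition is_quiver :: "'v::finite quiver \<Rightarrow> bool" where
  "is_quiver Q \<longleftrightarrow> (\<exists>b. skew_symmetrizable b \<and> Q = quiver_of_matrix b)"

text \<open>At most one of the two summands is nonzero in a quiver, so this is the weight of the
  unoriented edge between \<open>i\<close> and \<open>j\<close>.\<close>

definition edge_weight :: "'v quiver \<Rightarrow> 'v \<Rightarrow> 'v \<Rightarrow> nat" where
  "edge_weight Q i j = Q i j + Q j i"

definition oriented_cycle :: "'v quiver \<Rightarrow> 'v \<Rightarrow> 'v \<Rightarrow> 'v \<Rightarrow> bool" where
  "oriented_cycle Q i j k \<longleftrightarrow>
     (Q i j > 0 \<and> Q j k > 0 \<and> Q k i > 0) \<or> (Q i k > 0 \<and> Q k j > 0 \<and> Q j i > 0)"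

definition cycle_sign :: "'v quiver \<Rightarrow> 'v \<Rightarrow> 'v \<Rightarrow> 'v \<Rightarrow> real" where
  "cycle_sign Q i j k = (if oriented_cycle Q i j k then 1 else - 1)"

text \<open>\<open>Q'\<close> is the mutation of \<open>Q\<close> at \<open>k\<close>. The sign of the new edge in the second clause depends on
  its orientation in \<open>Q'\<close>, so that the equation determines both its weight and its direction.\<close>

definition quiver_mutation :: "'v::finite \<Rightarrow> 'v quiver \<Rightarrow> 'v quiver \<Rightarrow> bool" where
  "quiver_mutation k Q Q' \<longleftrightarrow> is_quiver Q' \<and>
     (\<forall>i. Q' i k = Q k i \<and> Q' k i = Q i k) \<and>
     (\<forall>i j. Q i k > 0 \<and> Q k j > 0 \<longrightarrow>
        cycle_sign Q i j k * sqrt (edge_weight Q i j)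
          + cycle_sign Q' i j k * sqrt (edge_weight Q' i j) = sqrt (Q i k * Q k j)) \<and>
     (\<forall>i j. i \<noteq> k \<and> j \<noteq> k \<and> \<not> (Q i k > 0 \<and> Q k j > 0) \<and> \<not> (Q j k > 0 \<and> Q k i > 0)
        \<longrightarrow> Q' i j = Q i j)"

definition same_diagram :: "'v quiver \<Rightarrow> 'v quiver \<Rightarrow> bool" where
  "same_diagram Q Q' \<longleftrightarrow>
     (\<exists>\<sigma>. bij \<sigma> \<and> (\<forall>i j. edge_weight Q' (\<sigma> i) (\<sigma> j) = edge_weight Q i j))"


section \<open>Dynkin diagrams\<close>

datatype dynkin_type = Dyn_A nat | Dyn_B nat | Dyn_C nat | Dyn_D nat | Dyn_E nat | Dyn_F4 | Dyn_G2

fun is_dynkin :: "dynkin_type \<Rightarrow> bool" where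
  "is_dynkin (Dyn_A n) \<longleftrightarrow> n \<ge> 1"
| "is_dynkin (Dyn_B n) \<longleftrightarrow> n \<ge> 2"
| "is_dynkin (Dyn_C n) \<longleftrightarrow> n \<ge> 3"
| "is_dynkin (Dyn_D n) \<longleftrightarrow> n \<ge> 4"
| "is_dynkin (Dyn_E n) \<longleftrightarrow> n \<in> {6, 7, 8}"
| "is_dynkin Dyn_F4 \<longleftrightarrow> True"
| "is_dynkin Dyn_G2 \<longleftrightarrow> True"

fun dynkin_rank :: "dynkin_type \<Rightarrow> nat" where
  "dynkin_rank (Dyn_A n) = n"
| "dynkin_rank (Dyn_B n) = n"
| "dynkin_rank (Dyn_C n) = n"
| "dynkin_rank (Dyn_D n) = n"
| "dynkin_rank (Dyn_E n) = n"
| "dynkin_rank Dyn_F4 = 4"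
| "dynkin_rank Dyn_G2 = 2"

text \<open>Edge multiplicities for \<open>i < j\<close>, on the nodes \<open>0, \<dots>, rank - 1\<close>. The diagrams are unoriented,
  so \<open>B\<^sub>n\<close> and \<open>C\<^sub>n\<close> coincide. In types \<open>D\<close> and \<open>E\<close> the nodes \<open>0, \<dots>, n - 2\<close> form a
  path and node \<open>n - 1\<close> is attached to node \<open>n - 3\<close>, respectively node \<open>2\<close>.\<close>

fun dynkin_edge_less :: "dynkin_type \<Rightarrow> nat \<Rightarrow> nat \<Rightarrow> nat" where
  "dynkin_edge_less (Dyn_A n) i j = (if j = Suc i then 1 else 0)"
| "dynkin_edge_less (Dyn_B n) i j = (if j = Suc i then (if Suc j = n then 2 else 1) else 0)"
| "dynkin_edge_less (Dyn_C n) i j = (if j = Suc i then (if Suc j = n then 2 else 1) else 0)"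
| "dynkin_edge_less (Dyn_D n) i j =
     (if (j = Suc i \<and> Suc j < n) \<or> (i + 3 = n \<and> Suc j = n) then 1 else 0)"
| "dynkin_edge_less (Dyn_E n) i j =
     (if (j = Suc i \<and> Suc j < n) \<or> (i = 2 \<and> Suc j = n) then 1 else 0)"
| "dynkin_edge_less Dyn_F4 i j = (if j = Suc i then (if i = 1 then 2 else 1) else 0)"
| "dynkin_edge_less Dyn_G2 i j = (if j = Suc i then 3 else 0)"

definition dynkin_edge :: "dynkin_type \<Rightarrow> nat \<Rightarrow> nat \<Rightarrow> nat" where
  "dynkin_edge \<Gamma> i j = dynkin_edge_less \<Gamma> (min i j) (max i j)"

definition dynkin_quiver :: "dynkin_type \<Rightarrow> 'v::finite quiver \<Rightarrow> bool" where
  "dynkin_quiver \<Gamma> Q \<longleftrightarrow> is_quiver Q \<and>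
     (\<exists>f. bij_betw f (UNIV :: 'v set) {..<dynkin_rank \<Gamma>} \<and>
          (\<forall>i j. edge_weight Q i j = dynkin_edge \<Gamma> (f i) (f j)))"


section \<open>Groups given by generators and relations\<close>

text \<open>\<open>(i, True)\<close> stands for the generator \<open>i\<close> and \<open>(i, False)\<close> for its inverse.\<close>

type_synonym 'v word = "('v \<times> bool) list"

inductive pres_eq :: "'v word set \<Rightarrow> 'v word \<Rightarrow> 'v word \<Rightarrow> bool" for R where
  refl: "pres_eq R u u"
| sym: "pres_eq R u v \<Longrightarrow> pres_eq R v u"
| trans: "pres_eq R u v \<Longrightarrow> pres_eq R v w \<Longrightarrow> pres_eq R u w"
| append: "pres_eq R u u' \<Longrightarrow> pres_eq R v v' \<Longrightarrow> pres_eq R (u @ v) (u' @ v')"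
| cancel: "pres_eq R [(i, b), (i, \<not> b)] []"
| relator: "r \<in> R \<Longrightarrow> pres_eq R r []"

definition pres_class :: "'v word set \<Rightarrow> 'v word \<Rightarrow> 'v word set" where
  "pres_class R u = {w. pres_eq R u w}"

definition presented_group :: "'v word set \<Rightarrow> 'v word set monoid" where
  "presented_group R =
     \<lparr>carrier = range (pres_class R),
      mult = (\<lambda>X Y. {w. \<exists>u\<in>X. \<exists>v\<in>Y. pres_eq R (u @ v) w}),
      one = pres_class R []\<rparr>"

lemma pres_class_eq_iff: "pres_class R u = pres_class R v \<longleftrightarrow> pres_eq R u v"
  unfolding pres_class_def by (blast intro: pres_eq.refl pres_eq.sym pres_eq.trans)

lemma pres_class_mult:
  "pres_class R u \<otimes>\<^bsub>presented_group R\<^esub> pres_class R v = pres_class R (u @ v)"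
  unfolding pres_class_def presented_group_def
  by (auto intro: pres_eq.refl pres_eq.sym pres_eq.trans pres_eq.append)

lemma pres_eq_inverse:
  "pres_eq R (rev (map (\<lambda>(i, b). (i, \<not> b)) u) @ u) []"
proof (induction u)
  case Nil
  show ?case by (simp add: pres_eq.refl)
next
  case (Cons a u)
  obtain i b where a: "a = (i, b)" by force
  let ?v = "rev (map (\<lambda>(i, b). (i, \<not> b)) u)"
  have "pres_eq R ([(i, \<not> b), (i, b)] @ u) ([] @ u)"
    using pres_eq.cancel[of R i "\<not> b"] by (intro pres_eq.append pres_eq.refl) simp
  then have "pres_eq R (?v @ [(i, \<not> b), (i, b)] @ u) (?v @ u)"
    by (intro pres_eq.append pres_eq.refl) simp
  with Cons show ?case
    by (auto simp: a intro: pres_eq.trans)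
qed

lemma group_presented_group: "group (presented_group R)"
proof (rule groupI)
  fix x assume "x \<in> carrier (presented_group R)"
  then obtain u where u: "x = pres_class R u"
    by (auto simp: presented_group_def)
  let ?y = "pres_class R (rev (map (\<lambda>(i, b). (i, \<not> b)) u))"
  have "?y \<otimes>\<^bsub>presented_group R\<^esub> x = \<one>\<^bsub>presented_group R\<^esub>"
    unfolding u pres_class_mult by (simp add: presented_group_def pres_class_eq_iff pres_eq_inverse)
  moreover have "?y \<in> carrier (presented_group R)"
    by (simp add: presented_group_def)
  ultimately show "\<exists>y\<in>carrier (presented_group R).
      y \<otimes>\<^bsub>presented_group R\<^esub> x = \<one>\<^bsub>presented_group R\<^esub>" by blast
next
  have carrier: "carrier (presented_group R) = range (pres_class R)"
    by (simp add: presented_group_def)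
  have one: "\<one>\<^bsub>presented_group R\<^esub> = pres_class R []"
    by (simp add: presented_group_def)
  show "\<And>x y. x \<in> carrier (presented_group R) \<Longrightarrow> y \<in> carrier (presented_group R) \<Longrightarrow>
      x \<otimes>\<^bsub>presented_group R\<^esub> y \<in> carrier (presented_group R)"
    by (auto simp: carrier pres_class_mult)
  show "\<one>\<^bsub>presented_group R\<^esub> \<in> carrier (presented_group R)"
    by (simp add: carrier one)
  show "\<And>x y z. x \<in> carrier (presented_group R) \<Longrightarrow> y \<in> carrier (presented_group R) \<Longrightarrow>
      z \<in> carrier (presented_group R) \<Longrightarrow>
      x \<otimes>\<^bsub>presented_group R\<^esub> y \<otimes>\<^bsub>presented_group R\<^esub> z =
      x \<otimes>\<^bsub>presented_group R\<^esub> (y \<otimes>\<^bsub>presented_group R\<^esub> z)"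
    by (auto simp: carrier pres_class_mult)
  show "\<And>x. x \<in> carrier (presented_group R) \<Longrightarrow> \<one>\<^bsub>presented_group R\<^esub> \<otimes>\<^bsub>presented_group R\<^esub> x = x"
    by (auto simp: carrier one pres_class_mult)
qed


section \<open>The Weyl group of a quiver\<close>

text \<open>Only the edge weights \<open>0, \<dots>, 3\<close> occur in Dynkin diagrams; the value \<open>0\<close> for other weights
  yields the trivial relation.\<close>

definition coxeter_exponent :: "'v quiver \<Rightarrow> 'v \<Rightarrow> 'v \<Rightarrow> nat" where
  "coxeter_exponent Q i j =
     (let c = edge_weight Q i j in
      if c = 0 then 2 else if c = 1 then 3 else if c = 2 then 4 else if c = 3 then 6 else 0)"

definition coxeter_relators :: "'v quiver \<Rightarrow> 'v word set" where
  "coxeter_relators Q =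
     {[(i, True), (i, True)] | i. True} \<union>
     {concat (replicate (coxeter_exponent Q i j) [(i, True), (j, True)]) | i j. i \<noteq> j}"

definition weyl_group :: "'v quiver \<Rightarrow> 'v word set monoid" where
  "weyl_group Q = presented_group (coxeter_relators Q)"

definition simple_reflection :: "'v quiver \<Rightarrow> 'v \<Rightarrow> 'v word set" where
  "simple_reflection Q i = pres_class (coxeter_relators Q) [(i, True)]"

definition simple_reflections :: "'v quiver \<Rightarrow> 'v word set set" where
  "simple_reflections Q = range (simple_reflection Q)"

definition reflections :: "'v quiver \<Rightarrow> 'v word set set" where
  "reflections Q =
     {w \<otimes>\<^bsub>weyl_group Q\<^esub> s \<otimes>\<^bsub>weyl_group Q\<^esub> inv\<^bsub>weyl_group Q\<^esub> w | w s.
        w \<in> carrier (weyl_group Q) \<and> s \<in> simple_reflections Q}"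


section \<open>Inner by diagram automorphisms\<close>

text \<open>As usual in HOL-Algebra, automorphisms are required to be \<open>undefined\<close> outside the carrier.\<close>

definition inner_automorphisms :: "('a, 'b) monoid_scheme \<Rightarrow> ('a \<Rightarrow> 'a) set" where
  "inner_automorphisms G =
     {(\<lambda>x\<in>carrier G. g \<otimes>\<^bsub>G\<^esub> x \<otimes>\<^bsub>G\<^esub> inv\<^bsub>G\<^esub> g) | g. g \<in> carrier G}"

definition diagram_automorphisms :: "'v quiver \<Rightarrow> ('v word set \<Rightarrow> 'v word set) set" where
  "diagram_automorphisms Q =
     {\<phi> \<in> auto (weyl_group Q). \<exists>\<pi>. bij \<pi> \<and>
        (\<forall>i j. i \<noteq> j \<longrightarrow> coxeter_exponent Q (\<pi> i) (\<pi> j) = coxeter_exponent Q i j) \<and>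
        (\<forall>i. \<phi> (simple_reflection Q i) = simple_reflection Q (\<pi> i))}"

definition inner_by_diagram_automorphisms ::
    "'v quiver \<Rightarrow> ('v word set \<Rightarrow> 'v word set) set" where
  "inner_by_diagram_automorphisms Q =
     generate (AutoGroup (weyl_group Q))
       (inner_automorphisms (weyl_group Q) \<union> diagram_automorphisms Q)"


section \<open>Mutation of attached elements\<close>

definition mutate_attached ::
    "('a, 'b) monoid_scheme \<Rightarrow> 'v \<Rightarrow> 'v quiver \<Rightarrow> ('v \<Rightarrow> 'a) \<Rightarrow> 'v \<Rightarrow> 'a" where
  "mutate_attached G k Q x i =
     (if Q i k > 0 then x k \<otimes>\<^bsub>G\<^esub> x i \<otimes>\<^bsub>G\<^esub> x k else x i)"

text \<open>\<open>mutation_seq G ks Q x Q' x'\<close>: mutating successively at the vertices \<open>ks\<close> leads from the quiver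
  \<open>Q\<close> with attached elements \<open>x\<close> of \<open>G\<close> to the quiver \<open>Q'\<close> with attached elements \<open>x'\<close>.\<close>

inductive mutation_seq ::
    "('a, 'b) monoid_scheme \<Rightarrow> 'v::finite list \<Rightarrow>
     'v quiver \<Rightarrow> ('v \<Rightarrow> 'a) \<Rightarrow> 'v quiver \<Rightarrow> ('v \<Rightarrow> 'a) \<Rightarrow> bool" for G where
  Nil: "mutation_seq G [] Q x Q x"
| Cons: "quiver_mutation k Q Q\<^sub>1 \<Longrightarrow> mutation_seq G ks Q\<^sub>1 (mutate_attached G k Q x) Q' x' \<Longrightarrow>
     mutation_seq G (k # ks) Q x Q' x'"

end

theory Submission
  imports Defs "HOL-Analysis.Finite_Cartesian_Product"
begin

text \<open>
  For an orientation of a Dynkin diagram mutation at a source only reverses arrows, while mutation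
  at a sink \<open>k\<close> reverses arrows and conjugates all attached elements by the one attached to \<open>k\<close>.
  As the quiver is acyclic, mutations at sources turn any vertex into a source, and then into a
  sink, at no cost (\<open>mutate_to_source\<close>). So from the simple reflections one reaches
  \<open>(w s\<^sub>i w\<^sup>-\<^sup>1)\<^sub>i\<close> for every word \<open>w\<close>, without ever leaving the orientations of \<open>\<Gamma>\<close>
  (\<open>mutation_seq_conjugation\<close>). This settles the claim on reflections, and one direction of the
  equivalence, because a diagram automorphism permutes \<open>S\<close> and therefore an inner by diagram
  automorphism maps \<open>S\<close> to a conjugate of \<open>S\<close>.

  Conversely, attached elements are always reflections, so it is enough that an
  automorphism \<open>\<alpha>\<close> mapping simple reflections to reflections is inner by diagram
  (\<open>reflection_preserving_auto\<close>). Here the Weyl group acts as a reflection group, on a space with a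
  basis of simple roots \<open>e i\<close>. Let \<open>\<alpha> s\<^sub>i\<close> be the reflection in the root \<open>\<beta> i\<close>. The order of
  the product of two reflections in roots is one of \<open>2, 3, 4, 6\<close> here and determines the inner
  product of the roots up to sign; as the diagram is a tree, the signs of the \<open>\<beta> i\<close> can be chosen such that
  \<open>e i \<mapsto> \<beta> i\<close> extends to an isometry \<open>g\<close>. It maps roots to roots since it intertwines \<open>w\<close> and
  \<open>\<alpha> w\<close>. Composing \<open>g\<close> with an element of the Weyl group that moves the
  image of the fundamental chamber back, one obtains an isometry that permutes the
  simple roots (\<open>isometry_simple_up_to_weyl\<close>); so \<open>\<alpha>\<close> followed by a conjugation permutes \<open>S\<close>.

  The facts on roots that this takes are proved for the presented group itself: every root is
  nonnegative or nonpositive, by induction on the length of words (\<open>act_simple_nonneg\<close>), hence the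
  action is faithful (\<open>elt_eqI\<close>); and there are finitely many roots, since the invariant form is
  positive definite and multiples of the roots lie in a lattice (\<open>finite_roots\<close>). Positive definiteness follows
  from an explicit positive vector for each Dynkin diagram (\<open>superharmonic_weights\<close>).
\<close>

section \<open>Mutation at sources and sinks\<close>

lemma quiver_of_matrix_pos_iff:
  assumes "skew_symmetrizable b"
  shows "quiver_of_matrix b i j > 0 \<longleftrightarrow> b i j > 0"
proof -
  obtain d :: "_ \<Rightarrow> int" where d: "\<And>i. d i > 0" "\<And>i j. d i * b i j = - (d j * b j i)"
    using assms by (auto simp: skew_symmetrizable_def)
  have "b j i \<noteq> 0" if "b i j > 0"
    using d(1)[of i] d(2)[of i j] that by auto
  then show ?thesis by (auto simp: quiver_of_matrix_def)
qed

lemma skew_symmetrizable_pos_iff: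
  assumes "skew_symmetrizable b"
  shows "b i j > 0 \<longleftrightarrow> b j i < 0"
proof -
  obtain d :: "_ \<Rightarrow> int" where d: "\<And>i. d i > 0" "\<And>i j. d i * b i j = - (d j * b j i)"
    using assms by (auto simp: skew_symmetrizable_def)
  have "d i * b i j > 0 \<longleftrightarrow> d j * b j i < 0" using d(2)[of i j] by linarith
  then show ?thesis
    using d(1)[of i] d(1)[of j] by (simp add: zero_less_mult_iff mult_less_0_iff)
qed

lemma edge_weight_matrix:
  assumes "skew_symmetrizable b"
  shows "edge_weight (quiver_of_matrix b) i j = nat \<bar>b i j * b j i\<bar>"
proof -
  consider "b i j > 0" "b j i < 0" | "b i j < 0" "b j i > 0" | "b i j = 0" "b j i = 0"
    using skew_symmetrizable_pos_iff[OF assms, of i j] skew_symmetrizable_pos_iff[OF assms, of j i] by linarith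
  then show ?thesis
    by cases (simp_all add: edge_weight_def quiver_of_matrix_def mult.commute)
qed

lemma is_quiver_no_2_cycle:
  assumes "is_quiver Q" "Q i j > 0"
  shows "Q j i = 0"
proof -
  obtain b where b: "skew_symmetrizable b" "Q = quiver_of_matrix b"
    using assms by (auto simp: is_quiver_def)
  have "\<not> Q j i > 0"
    using assms(2) skew_symmetrizable_pos_iff[OF b(1)] unfolding b(2) quiver_of_matrix_pos_iff[OF b(1)]
    by (metis less_asym)
  then show ?thesis by simp
qed

lemma is_quiver_no_loop: "is_quiver Q \<Longrightarrow> Q i i = 0"
  using is_quiver_no_2_cycle[of Q i i] by auto

definition flip_at :: "'v \<Rightarrow> 'v quiver \<Rightarrow> 'v quiver" where
  "flip_at k Q = (\<lambda>i j. if i = k \<or> j = k then Q j i else Q i j)"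

lemma edge_weight_flip_at [simp]: "edge_weight (flip_at k Q) = edge_weight Q"
  by (auto simp: edge_weight_def flip_at_def fun_eq_iff)

lemma is_quiver_flip_at:
  assumes "is_quiver Q"
  shows "is_quiver (flip_at k Q)"
proof -
  obtain b where b: "skew_symmetrizable b" "Q = quiver_of_matrix b"
    using assms by (auto simp: is_quiver_def)
  define b' where "b' = (\<lambda>i j. if i = k \<or> j = k then - b i j else b i j)"
  have "skew_symmetrizable b'"
    using b(1) unfolding skew_symmetrizable_def b'_def by auto
  moreover have "flip_at k Q = quiver_of_matrix b'"
    unfolding b(2) flip_at_def quiver_of_matrix_def b'_def fun_eq_iff
    using skew_symmetrizable_pos_iff[OF b(1)] by (auto simp: mult.commute)
  ultimately show ?thesis unfolding is_quiver_def by blast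
qed

text \<open>At a source or a sink no oriented path passes through, so that only the reversal of arrows
  remains of a mutation.\<close>

lemma quiver_mutation_source_or_sink:
  assumes "is_quiver Q" and "(\<forall>i. Q i k = 0) \<or> (\<forall>i. Q k i = 0)"
  shows "quiver_mutation k Q (flip_at k Q)"
  using assms is_quiver_flip_at[OF assms(1), of k]
  by (auto simp: quiver_mutation_def flip_at_def)

lemma mutation_seq_append:
  assumes "mutation_seq G ks Q x Q' x'" "mutation_seq G ls Q' x' Q'' x''"
  shows "mutation_seq G (ks @ ls) Q x Q'' x''"
  using assms by (induction rule: mutation_seq.induct) (auto intro: mutation_seq.Cons)

lemma mutation_seq_snoc:
  assumes "mutation_seq G ks Q x Q' x'" "quiver_mutation k Q' Q''"
  shows "mutation_seq G (ks @ [k]) Q x Q'' (mutate_attached G k Q' x')"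
  using mutation_seq_append[OF assms(1)] mutation_seq.Cons[OF assms(2) mutation_seq.Nil] by blast

lemma mutate_attached_source:
  assumes "\<And>i. Q i k = 0"
  shows "mutate_attached G k Q x = x"
  using assms by (simp add: mutate_attached_def fun_eq_iff)

text \<open>Such a numbering shows that the underlying graph is a forest, and lets one go through it
  vertex by vertex so that each new vertex is joined to at most one earlier one.\<close>

definition one_lower_neighbour :: "('v \<Rightarrow> nat) \<Rightarrow> 'v quiver \<Rightarrow> bool" where
  "one_lower_neighbour f Q \<longleftrightarrow> inj f \<and>
     (\<forall>a b c. f a < f c \<and> f b < f c \<and> edge_weight Q a c > 0 \<and> edge_weight Q b c > 0 \<longrightarrow> a = b)"

text \<open>The vertex of a directed cycle with the largest number would have its predecessor and its
  successor on the cycle as two smaller neighbours; they would coincide and form a 2-cycle.\<close>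

lemma acyclic_of_one_lower_neighbour:
  fixes Q :: "'v::finite quiver"
  assumes "is_quiver Q" and f: "one_lower_neighbour f Q"
  shows "acyclic {(a, b). Q a b > 0}"
proof (rule ccontr)
  let ?r = "{(a, b). Q a b > 0}"
  let ?C = "{a. (a, a) \<in> ?r\<^sup>+}"
  assume "\<not> acyclic ?r"
  then have C: "finite (f ` ?C)" "f ` ?C \<noteq> {}" by (auto simp: acyclic_def)
  obtain a where a: "(a, a) \<in> ?r\<^sup>+" and "f a = Max (f ` ?C)"
    using Max_in[OF C] by auto
  then have max: "f b \<le> f a" if "(b, b) \<in> ?r\<^sup>+" for b
    using that C(1) by auto
  obtain b where b: "(a, b) \<in> ?r" "(b, a) \<in> ?r\<^sup>*"
    using a by (meson tranclD)
  obtain c where c: "(c, a) \<in> ?r" "(a, c) \<in> ?r\<^sup>*"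
    using a by (meson tranclD2)
  have "f b \<le> f a" using b by (intro max) (meson rtrancl_into_trancl1)
  moreover have "f c \<le> f a" using c by (intro max) (meson rtrancl_into_trancl2)
  moreover have "a \<noteq> b" "a \<noteq> c" using b(1) c(1) is_quiver_no_loop[OF assms(1)] by auto
  ultimately have "f b < f a" "f c < f a"
    using f by (auto simp: one_lower_neighbour_def inj_def order.order_iff_strict)
  with b(1) c(1) f have "b = c"
    by (auto simp: one_lower_neighbour_def edge_weight_def)
  with b(1) c(1) show False
    using is_quiver_no_2_cycle[OF assms(1), of a b] by simp
qed

text \<open>Mutating at a source \<open>j \<noteq> k\<close> among the vertices from which \<open>k\<close> can be reached makes \<open>j\<close> a
  sink, so that \<open>k\<close> can be reached from fewer vertices. Thus finitely many mutations at sources,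
  none of which changes the attached elements, make \<open>k\<close> a source.\<close>

lemma mutate_to_source:
  fixes Q :: "'v::finite quiver"
  assumes "is_quiver Q" and "one_lower_neighbour f Q"
  shows "\<exists>ks Q'. mutation_seq G ks Q x Q' x \<and> is_quiver Q' \<and> edge_weight Q' = edge_weight Q \<and>
           (\<forall>i. Q' i k = 0)"
  using assms
proof (induction "card {a. (a, k) \<in> {(a, b). Q a b > 0}\<^sup>+}" arbitrary: Q rule: less_induct)
  case less
  let ?r = "{(a, b). Q a b > 0}"
  let ?P = "{a. (a, k) \<in> ?r\<^sup>+}"
  show ?case
  proof (cases "?P = {}")
    case True
    have "Q i k = 0" for i
    proof (rule ccontr)
      assume "Q i k \<noteq> 0"
      then have "(i, k) \<in> ?r" by simp
      then have "(i, k) \<in> ?r\<^sup>+" by (rule trancl.r_into_trancl)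
      with True show False by simp
    qed
    then show ?thesis using less.prems mutation_seq.Nil by blast
  next
    case False
    have acyc: "acyclic ?r" using acyclic_of_one_lower_neighbour less.prems by blast
    then have "wf ?r" by (intro finite_acyclic_wf) auto
    then obtain j where j: "j \<in> ?P" "\<And>y. (y, j) \<in> ?r \<Longrightarrow> y \<notin> ?P"
      using False by (metis wfE_min ex_in_conv)
    have source: "Q y j = 0" for y
    proof (rule ccontr)
      assume "Q y j \<noteq> 0"
      then have yj: "(y, j) \<in> ?r" by simp
      then have "(y, k) \<in> ?r\<^sup>+" using j(1) by (simp add: trancl_into_trancl2)
      with j(2)[OF yj] show False by simp
    qed
    let ?Q = "flip_at j Q"
    let ?r' = "{(a, b). ?Q a b > 0}"
    have jk: "j \<noteq> k" using j(1) acyc by (auto simp: acyclic_def)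
    have sink: "?Q j y = 0" for y using source by (simp add: flip_at_def)
    have sub: "(a, k) \<in> ?r\<^sup>+ \<and> a \<noteq> j" if "(a, k) \<in> ?r'\<^sup>+" for a
      using that
    proof (induction rule: converse_trancl_induct)
      case (base a)
      then have "a \<noteq> j" using sink by auto
      then have "(a, k) \<in> ?r" using base jk by (auto simp: flip_at_def)
      then show ?case using \<open>a \<noteq> j\<close> by blast
    next
      case (step a b)
      then have "a \<noteq> j" using sink by auto
      then have "(a, b) \<in> ?r" using step by (auto simp: flip_at_def)
      then show ?case using \<open>a \<noteq> j\<close> step.IH by (meson trancl_into_trancl2)
    qed
    then have "{a. (a, k) \<in> ?r'\<^sup>+} \<subset> ?P" using j(1) by blast
    then have "card {a. (a, k) \<in> ?r'\<^sup>+} < card ?P" by (simp add: psubset_card_mono)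
    moreover have "one_lower_neighbour f ?Q"
      using less.prems(2) by (simp add: one_lower_neighbour_def)
    ultimately obtain ks Q' where Q': "mutation_seq G ks ?Q x Q' x" "is_quiver Q'"
        "edge_weight Q' = edge_weight ?Q" "\<forall>i. Q' i k = 0"
      using less.hyps less.prems is_quiver_flip_at by blast
    have "mutation_seq G (j # ks) Q x Q' x"
      using Q'(1) quiver_mutation_source_or_sink[OF less.prems(1)] source
      by (intro mutation_seq.Cons) (auto simp: mutate_attached_source)
    with Q' show ?thesis by auto
  qed
qed

section \<open>Reflections of a symmetric bilinear form\<close>

locale symmetric_form =
  fixes B :: "'a::real_vector \<Rightarrow> 'a \<Rightarrow> real"
  assumes form_sym: "B x y = B y x"
    and form_add_left: "B (x + y) z = B x z + B y z"
    and form_scale_left: "B (r *\<^sub>R x) z = r * B x z"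
begin

lemma form_add_right: "B z (x + y) = B z x + B z y"
  by (simp only: form_sym[of z _] form_add_left)

lemma form_scale_right: "B z (r *\<^sub>R x) = r * B z x"
  by (simp only: form_sym[of z _] form_scale_left)

lemma form_minus_left: "B (- x) z = - B x z"
  using form_scale_left[of "-1" x z] by simp

lemma form_minus_right: "B z (- x) = - B z x"
  by (simp only: form_sym[of z _] form_minus_left)

lemma form_diff_left: "B (x - y) z = B x z - B y z"
  using form_add_left[of x "- y" z] by (simp add: form_minus_left)

lemma form_diff_right: "B z (x - y) = B z x - B z y"
  by (simp only: form_sym[of z _] form_diff_left)

lemma form_zero_left [simp]: "B 0 z = 0"
  using form_scale_left[of 0 0 z] by simp

lemma form_sum_left: "B (\<Sum>i\<in>A. f i) z = (\<Sum>i\<in>A. B (f i) z)"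
  by (induction A rule: infinite_finite_induct) (auto simp: form_add_left)

lemma form_sum_right: "B z (\<Sum>i\<in>A. f i) = (\<Sum>i\<in>A. B z (f i))"
  by (simp only: form_sym[of z _] form_sum_left)

lemmas form_simps = form_add_left form_add_right form_scale_left form_scale_right
  form_minus_left form_minus_right form_diff_left form_diff_right

text \<open>For \<open>B b b = 2\<close> this is the reflection in the hyperplane orthogonal to \<open>b\<close>.\<close>

definition reflect :: "'a \<Rightarrow> 'a \<Rightarrow> 'a" where
  "reflect b x = x - B x b *\<^sub>R b"

lemma reflect_add: "reflect b (x + y) = reflect b x + reflect b y"
  by (simp add: reflect_def form_simps algebra_simps)

lemma reflect_scale: "reflect b (r *\<^sub>R x) = r *\<^sub>R reflect b x"
  by (simp add: reflect_def form_simps algebra_simps)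

lemma reflect_uminus: "reflect (- b) = reflect b"
  by (rule ext) (simp add: reflect_def form_simps)

lemma reflect_self: "B b b = 2 \<Longrightarrow> reflect b b = - b"
  by (simp add: reflect_def scaleR_2)

lemma reflect_reflect: "B b b = 2 \<Longrightarrow> reflect b (reflect b x) = x"
  by (simp add: reflect_def form_simps algebra_simps)

lemma reflect_isometry: "B b b = 2 \<Longrightarrow> B (reflect b x) (reflect b y) = B x y"
  by (simp add: reflect_def form_simps algebra_simps form_sym[of b x] form_sym[of b y])

lemma reflect_reflect_commute:
  assumes "B b b = 2"
  shows "reflect (reflect b c) (reflect b x) = reflect b (reflect c x)"
proof -
  have "reflect (reflect b c) (reflect b x) = reflect b x - B x c *\<^sub>R reflect b c"
    by (simp add: reflect_def[of "reflect b c"] reflect_isometry[OF assms])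
  also have "\<dots> = reflect b (reflect c x)"
    by (simp add: reflect_def form_simps algebra_simps)
  finally show ?thesis .
qed

lemma reflect_conj: "B b b = 2 \<Longrightarrow> reflect b (reflect c (reflect b x)) = reflect (reflect b c) x"
  using reflect_reflect_commute[of b c "reflect b x"] reflect_reflect[of b x] by simp

text \<open>Vectors of the same norm on a line agree up to sign, so that a reflection determines its root
  up to sign.\<close>

lemma eq_or_eq_uminus_of_multiples:
  assumes "B b b = 2" "B c c = 2" "r *\<^sub>R b = s *\<^sub>R c" "r \<noteq> 0"
  shows "b = c \<or> b = - c"
proof -
  have "B (r *\<^sub>R b) (r *\<^sub>R b) = B (s *\<^sub>R c) (s *\<^sub>R c)" using assms(3) by simp
  then have "r\<^sup>2 = s\<^sup>2" using assms(1,2) by (simp add: form_simps power2_eq_square)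
  then have "s = r \<or> s = - r" by (metis power2_eq_iff)
  then have "r *\<^sub>R b = r *\<^sub>R c \<or> r *\<^sub>R b = r *\<^sub>R (- c)" using assms(3) by auto
  then show ?thesis using assms(4) by (simp only: scaleR_cancel_left) simp
qed

lemma reflect_eq_imp:
  assumes "B b b = 2" "B c c = 2" "reflect b = reflect c"
  shows "b = c \<or> b = - c"
proof -
  have "- b = b - B b c *\<^sub>R c"
    using reflect_self[OF assms(1)] assms(3) by (simp add: reflect_def)
  then have "2 *\<^sub>R b = B b c *\<^sub>R c" by (simp add: scaleR_2 algebra_simps)
  then show ?thesis using assms(1,2) by (rule_tac eq_or_eq_uminus_of_multiples) auto
qed

lemma reflect_commute:
  assumes "B b c = 0"
  shows "reflect b (reflect c x) = reflect c (reflect b x)"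
  using assms form_sym[of c b] by (simp add: reflect_def form_simps algebra_simps)

lemma reflect_commute_imp:
  assumes "B b b = 2" "B c c = 2" "\<And>x. reflect b (reflect c x) = reflect c (reflect b x)"
  shows "B b c = 0 \<or> b = c \<or> b = - c"
proof -
  have "reflect (reflect b c) x = reflect c x" for x
  proof -
    have "reflect (reflect b c) x = reflect b (reflect c (reflect b x))" by (rule reflect_conj[OF assms(1), symmetric])
    also have "\<dots> = reflect b (reflect b (reflect c x))" by (simp only: assms(3))
    finally show ?thesis by (simp only: reflect_reflect[OF assms(1)])
  qed
  then have "reflect b c = c \<or> reflect b c = - c"
    using assms by (intro reflect_eq_imp) (auto simp: reflect_isometry)
  then show ?thesis
  proof
    assume "reflect b c = c"
    then have "B c b *\<^sub>R b = 0" by (simp add: reflect_def)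
    then show ?thesis using assms(1) form_sym[of b c] by auto
  next
    assume "reflect b c = - c"
    then have "2 *\<^sub>R c = B c b *\<^sub>R b" by (simp add: reflect_def scaleR_2 algebra_simps)
    then have "c = b \<or> c = - b"
      using assms(1,2) by (rule_tac eq_or_eq_uminus_of_multiples) auto
    then show ?thesis by auto
  qed
qed

text \<open>The dihedral relations of orders \<open>3\<close>, \<open>4\<close> and \<open>6\<close> say that two conjugates coincide or
  commute.\<close>

lemma reflect_braid_3:
  assumes "B b b = 2" "B c c = 2" "(B b c)\<^sup>2 = 1"
  shows "reflect b (reflect c (reflect b x)) = reflect c (reflect b (reflect c x))"
proof -
  have "B b c = 1 \<or> B b c = - 1" using assms(3) by (simp add: power2_eq_1_iff)
  then have "reflect b c = reflect c b \<or> reflect b c = - reflect c b"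
    by (auto simp: reflect_def form_sym[of c b])
  then have "reflect (reflect b c) = reflect (reflect c b)" using reflect_uminus by metis
  then show ?thesis using assms by (simp add: reflect_conj)
qed

lemma reflect_braid_4:
  assumes "B b b = 2" "B c c = 2" "(B b c)\<^sup>2 = 2"
  shows "reflect b (reflect c (reflect b (reflect c x))) = reflect c (reflect b (reflect c (reflect b x)))"
proof -
  have "B b (reflect c b) = 0"
    using assms by (simp add: reflect_def form_simps power2_eq_square)
  from reflect_commute[OF this, of x] show ?thesis using assms by (simp flip: reflect_conj)
qed

lemma reflect_braid_6:
  assumes "B b b = 2" "B c c = 2" "(B b c)\<^sup>2 = 3"
  shows "reflect b (reflect c (reflect b (reflect c (reflect b (reflect c x))))) =
         reflect c (reflect b (reflect c (reflect b (reflect c (reflect b x)))))"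
proof -
  have "B (reflect b c) (reflect c b) = B b c * ((B b c)\<^sup>2 - 3)"
    using assms(1,2) by (simp add: reflect_def form_simps form_sym[of c b] power2_eq_square algebra_simps)
  then have "B (reflect b c) (reflect c b) = 0" using assms by simp
  from reflect_commute[OF this, of x] show ?thesis using assms by (simp flip: reflect_conj)
qed

lemma reflect_braid_3_imp:
  assumes "B b b = 2" "B c c = 2"
    and "\<And>x. reflect b (reflect c (reflect b x)) = reflect c (reflect b (reflect c x))"
  shows "(B b c)\<^sup>2 = 1 \<or> b = c \<or> b = - c"
proof -
  let ?a = "B b c"
  have "reflect (reflect b c) = reflect (reflect c b)"
    using assms(3) by (auto simp: reflect_conj assms(1,2))
  then have "reflect b c = reflect c b \<or> reflect b c = - reflect c b"
    using assms by (intro reflect_eq_imp) (auto simp: reflect_isometry)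
  then have "c - ?a *\<^sub>R b = b - ?a *\<^sub>R c \<or> c - ?a *\<^sub>R b = - (b - ?a *\<^sub>R c)"
    by (simp add: reflect_def form_sym[of c b])
  then have "(1 + ?a) *\<^sub>R (c - b) = 0 \<or> (1 - ?a) *\<^sub>R (c + b) = 0"
    by (auto simp: algebra_simps)
  then have "1 + ?a = 0 \<or> 1 - ?a = 0 \<or> b = c \<or> b = - c"
    by (auto simp: add_eq_0_iff)
  then have "?a = - 1 \<or> ?a = 1 \<or> b = c \<or> b = - c" by auto
  then show ?thesis by auto
qed

lemma reflect_braid_4_imp:
  assumes "B b b = 2" "B c c = 2"
    and "\<And>x. reflect b (reflect c (reflect b (reflect c x))) = reflect c (reflect b (reflect c (reflect b x)))"
  shows "(B b c)\<^sup>2 = 2 \<or> B b c = 0 \<or> b = c \<or> b = - c"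
proof -
  have "reflect b (reflect (reflect c b) x) = reflect (reflect c b) (reflect b x)" for x
    using assms(3)[of x] by (simp flip: reflect_conj[OF assms(2)])
  then have "B b (reflect c b) = 0 \<or> b = reflect c b \<or> b = - reflect c b"
    using assms by (intro reflect_commute_imp) (auto simp: reflect_isometry)
  moreover have "(B b c)\<^sup>2 = 2" if "B b (reflect c b) = 0"
    using that assms by (simp add: reflect_def form_simps power2_eq_square)
  moreover have "B b c = 0" if "b = reflect c b"
    using arg_cong[OF that, of "\<lambda>x. B x c"] assms by (simp add: reflect_def form_simps)
  moreover have "b = c \<or> b = - c" if "b = - reflect c b"
  proof -
    have "2 *\<^sub>R b = B b c *\<^sub>R c" using that by (simp add: reflect_def scaleR_2 algebra_simps)
    then show ?thesis using assms(1,2) by (rule_tac eq_or_eq_uminus_of_multiples) auto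
  qed
  ultimately show ?thesis by blast
qed

lemma reflect_braid_6_imp:
  assumes "B b b = 2" "B c c = 2"
    and "\<And>x. reflect b (reflect c (reflect b (reflect c (reflect b (reflect c x))))) =
              reflect c (reflect b (reflect c (reflect b (reflect c (reflect b x)))))"
  shows "(B b c)\<^sup>2 = 3 \<or> (B b c)\<^sup>2 = 1 \<or> B b c = 0 \<or> b = c \<or> b = - c"
proof -
  have "reflect (reflect b c) (reflect (reflect c b) x) = reflect (reflect c b) (reflect (reflect b c) x)" for x
    using assms(3)[of x] by (simp flip: reflect_conj[OF assms(2)] reflect_conj[OF assms(1)])
  then have "B (reflect b c) (reflect c b) = 0 \<or> reflect b c = reflect c b \<or> reflect b c = - reflect c b"
    using assms by (intro reflect_commute_imp) (auto simp: reflect_isometry)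
  moreover have "(B b c)\<^sup>2 = 1 \<or> b = c \<or> b = - c"
    if "reflect b c = reflect c b \<or> reflect b c = - reflect c b"
  proof (rule reflect_braid_3_imp[OF assms(1,2)])
    have "reflect (reflect b c) = reflect (reflect c b)" using that reflect_uminus by metis
    then show "reflect b (reflect c (reflect b x)) = reflect c (reflect b (reflect c x))" for x
      by (simp add: reflect_conj assms(1,2))
  qed
  moreover have "B (reflect b c) (reflect c b) = B b c * ((B b c)\<^sup>2 - 3)"
    using assms(1,2) by (simp add: reflect_def form_simps form_sym[of c b] power2_eq_square algebra_simps)
  ultimately show ?thesis by auto
qed

end

section \<open>The geometric representation\<close>

locale weyl_quiver =
  fixes Q :: "'v::finite quiver"
  assumes quiver: "is_quiver Q" and edge_weight_le_3: "edge_weight Q i j \<le> 3"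
begin

lemma edge_weight_sym: "edge_weight Q i j = edge_weight Q j i"
  by (simp add: edge_weight_def)

lemma edge_weight_self [simp]: "edge_weight Q i i = 0"
  using is_quiver_no_loop[OF quiver] by (simp add: edge_weight_def)

lemma edge_weight_cases:
  obtains "edge_weight Q i j = 0" | "edge_weight Q i j = 1" | "edge_weight Q i j = 2" | "edge_weight Q i j = 3"
  using edge_weight_le_3[of i j] by linarith

subsection \<open>Elements of the Weyl group as words in the simple reflections\<close>

definition elt :: "'v list \<Rightarrow> 'v word set" where
  "elt us = pres_class (coxeter_relators Q) (map (\<lambda>i. (i, True)) us)"

sublocale W: group "weyl_group Q"
  unfolding weyl_group_def by (rule group_presented_group)

lemma one_elt: "\<one>\<^bsub>weyl_group Q\<^esub> = elt []"
  by (simp add: weyl_group_def presented_group_def elt_def)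

lemma elt_append: "elt (us @ vs) = elt us \<otimes>\<^bsub>weyl_group Q\<^esub> elt vs"
  by (simp add: weyl_group_def pres_class_mult elt_def)

lemma simple_reflection_elt: "simple_reflection Q i = elt [i]"
  by (simp add: simple_reflection_def elt_def)

lemma elt_closed [simp]: "elt us \<in> carrier (weyl_group Q)"
  by (simp add: weyl_group_def presented_group_def elt_def)

lemma elt_square: "elt [i, i] = elt []"
  unfolding elt_def pres_class_eq_iff
  by (auto intro!: pres_eq.relator simp: coxeter_relators_def)

text \<open>Formal inverses are redundant, as the generators are involutions.\<close>

lemma carrier_elt: "carrier (weyl_group Q) = range elt"
proof -
  let ?R = "coxeter_relators Q"
  have "pres_eq ?R u (map (\<lambda>i. (i, True)) (map fst u))" for u
  proof (induction u)
    case Nil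
    show ?case by (simp add: pres_eq.refl)
  next
    case (Cons a u)
    obtain i b where a: "a = (i, b)" by force
    have "pres_eq ?R [(i, b)] [(i, True)]"
    proof (cases b)
      case True
      then show ?thesis by (simp add: pres_eq.refl)
    next
      case False
      have "pres_eq ?R [(i, True), (i, True)] []"
        by (auto intro!: pres_eq.relator simp: coxeter_relators_def)
      then have "pres_eq ?R ([(i, False)] @ [(i, True), (i, True)]) [(i, False)]"
        using pres_eq.append[OF pres_eq.refl, of ?R _ "[]" "[(i, False)]"] by simp
      moreover have "pres_eq ?R ([(i, False), (i, True)] @ [(i, True)]) ([] @ [(i, True)])"
        using pres_eq.cancel[of ?R i False] by (intro pres_eq.append pres_eq.refl) simp
      ultimately show ?thesis using False by (auto intro: pres_eq.trans pres_eq.sym)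
    qed
    from pres_eq.append[OF this Cons] show ?case by (simp add: a)
  qed
  then have "pres_class ?R u = elt (map fst u)" for u
    unfolding elt_def pres_class_eq_iff .
  moreover have "carrier (weyl_group Q) = range (pres_class ?R)"
    by (simp add: weyl_group_def presented_group_def)
  moreover have "elt us = pres_class ?R (map (\<lambda>i. (i, True)) us)" for us
    by (rule elt_def)
  ultimately show ?thesis by (metis (no_types, lifting) range_eqI rangeE subsetI subset_antisym)
qed

lemma elt_cong: "elt u = elt u' \<Longrightarrow> elt v = elt v' \<Longrightarrow> elt (u @ v) = elt (u' @ v')"
  by (simp add: elt_append)

lemma elt_cancel_pair: "elt (u @ i # i # v) = elt (u @ v)"
  using elt_cong[OF HOL.refl elt_cong[OF elt_square HOL.refl], of u i v] by simp

lemma elt_rev_cancel: "elt (rev u @ u) = elt []"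
proof (induction u)
  case (Cons i u)
  then show ?case using elt_cancel_pair[of "rev u" i u] by simp
qed simp

lemma inv_elt: "inv\<^bsub>weyl_group Q\<^esub> elt u = elt (rev u)"
  using elt_rev_cancel[of u] by (intro W.inv_equality) (simp_all add: one_elt flip: elt_append)

lemma elt_eq_rev:
  assumes "elt (u @ v) = elt []"
  shows "elt u = elt (rev v)"
  using elt_cong[OF assms HOL.refl, of "rev v"] elt_cong[OF HOL.refl elt_rev_cancel[of "rev v"], of u] by simp

lemma elt_reflection: "elt u \<otimes>\<^bsub>weyl_group Q\<^esub> simple_reflection Q i \<otimes>\<^bsub>weyl_group Q\<^esub> inv\<^bsub>weyl_group Q\<^esub> elt u
    = elt (u @ [i] @ rev u)"
  by (simp add: simple_reflection_elt inv_elt W.m_assoc flip: elt_append)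

lemma reflections_elt: "reflections Q = {elt (u @ [i] @ rev u) | u i. True}"
proof -
  have "reflections Q = {elt u \<otimes>\<^bsub>weyl_group Q\<^esub> simple_reflection Q i \<otimes>\<^bsub>weyl_group Q\<^esub>
      inv\<^bsub>weyl_group Q\<^esub> elt u | u i. True}"
    unfolding reflections_def simple_reflections_def carrier_elt by blast
  then show ?thesis by (simp only: elt_reflection)
qed

lemma elt_coxeter_relation:
  assumes "i \<noteq> j"
  shows "elt (concat (replicate (coxeter_exponent Q i j) [i, j])) = elt []"
proof -
  have "map (\<lambda>i. (i, True)) (concat (replicate n [i, j])) =
      concat (replicate n [(i, True), (j, True)])" for n
    by (induction n) auto
  then show ?thesis
    using assms unfolding elt_def pres_class_eq_iff
    by (auto intro!: pres_eq.relator simp: coxeter_relators_def)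
qed

subsection \<open>The invariant form\<close>

text \<open>Since \<open>2 cos (\<pi> / m) = sqrt c\<close> for \<open>(c, m) = (0, 2), (1, 3), (2, 4), (3, 6)\<close>, this is twice the
  form that is classically attached to the Coxeter group.\<close>

definition cartan :: "'v \<Rightarrow> 'v \<Rightarrow> real" where
  "cartan i j = (if i = j then 2 else - sqrt (edge_weight Q i j))"

definition form :: "real^'v \<Rightarrow> real^'v \<Rightarrow> real" where
  "form x y = (\<Sum>i\<in>UNIV. \<Sum>j\<in>UNIV. cartan i j * x $ i * y $ j)"

lemma cartan_sym: "cartan i j = cartan j i"
  by (simp add: cartan_def edge_weight_sym)

lemma cartan_self [simp]: "cartan i i = 2"
  by (simp add: cartan_def)

sublocale symmetric_form form
proof
  show "form x y = form y x" for x y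
    unfolding form_def by (subst sum.swap) (simp add: cartan_sym mult_ac)
qed (simp_all add: form_def algebra_simps sum.distrib sum_distrib_left)

abbreviation e :: "'v \<Rightarrow> real^'v" where "e i \<equiv> axis i 1"

lemma e_nth_mult: "e i $ j * c = (if j = i then c else 0)" "c * e i $ j = (if j = i then c else 0)"
  by (simp_all add: axis_def)

lemma vec_expansion: "x = (\<Sum>i\<in>UNIV. x $ i *\<^sub>R e i)" for x :: "real^'v"
  by (simp add: vec_eq_iff e_nth_mult)

lemma form_e_right: "form x (e j) = (\<Sum>i\<in>UNIV. x $ i * cartan i j)"
  by (simp add: form_def e_nth_mult mult.commute)

lemma form_e_e: "form (e i) (e j) = cartan i j"
  by (simp add: form_e_right e_nth_mult)

lemma form_e_self [simp]: "form (e i) (e i) = 2"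
  by (simp add: form_e_e)

lemma form_expand_right: "form x y = (\<Sum>i\<in>UNIV. y $ i * form x (e i))"
  by (subst vec_expansion[of y]) (simp only: form_sum_right form_simps)

subsection \<open>The action\<close>

primrec act :: "'v list \<Rightarrow> real^'v \<Rightarrow> real^'v" where
  "act [] x = x"
| "act (i # us) x = reflect (e i) (act us x)"

lemma act_append: "act (us @ vs) x = act us (act vs x)"
  by (induction us) auto

lemma act_add: "act u (x + y) = act u x + act u y"
  by (induction u) (auto simp: reflect_add)

lemma act_scale: "act u (r *\<^sub>R x) = r *\<^sub>R act u x"
  by (induction u) (auto simp: reflect_scale)

lemma act_uminus: "act u (- x) = - act u x"
  using act_scale[of u "-1" x] by simp

lemma act_sum: "act u (\<Sum>i\<in>A. f i) = (\<Sum>i\<in>A. act u (f i))"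
proof (induction A rule: infinite_finite_induct)
  case (infinite A)
  then show ?case using act_scale[of u 0] by simp
next
  case empty
  then show ?case using act_scale[of u 0] by simp
qed (simp add: act_add)

lemma act_isometry: "form (act u x) (act u y) = form x y"
  by (induction u) (auto simp: reflect_isometry)

lemma act_rev_cancel: "act (rev u) (act u x) = x"
  by (induction u arbitrary: x) (auto simp: act_append reflect_reflect)

lemma act_rev_cancel': "act u (act (rev u) x) = x"
  using act_rev_cancel[of "rev u"] by simp

lemma reflect_act: "reflect (act u b) (act u x) = act u (reflect b x)"
  using act_add[of u x "- form x b *\<^sub>R b"]
  by (simp add: reflect_def act_isometry act_uminus act_scale)

lemma act_reflection: "act (u @ [i] @ rev u) x = reflect (act u (e i)) x"
  using reflect_act[of u "e i" "act (rev u) x"] by (simp add: act_append act_rev_cancel')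

text \<open>\<open>form (e i) (e j)\<close> is chosen such that its square is the edge weight, which puts the dihedral
  relations above at one's disposal.\<close>

lemma act_coxeter_relation:
  assumes "i \<noteq> j"
  shows "act (concat (replicate (coxeter_exponent Q i j) [i, j])) x = x"
proof -
  have sq: "(form (e i) (e j))\<^sup>2 = edge_weight Q i j"
    using assms by (simp add: form_e_e cartan_def)
  show ?thesis
  proof (cases i j rule: edge_weight_cases)
    case 1
    then have "form (e i) (e j) = 0" using sq by simp
    from reflect_commute[OF this] 1 show ?thesis
      by (simp add: coxeter_exponent_def numeral_eq_Suc reflect_reflect)
  next
    case 2
    from reflect_braid_3[OF form_e_self form_e_self, of i j] sq 2 show ?thesis
      by (simp add: coxeter_exponent_def numeral_eq_Suc reflect_reflect)
  next
    case 3
    from reflect_braid_4[OF form_e_self form_e_self, of i j] sq 3 show ?thesis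
      by (simp add: coxeter_exponent_def numeral_eq_Suc reflect_reflect)
  next
    case 4
    from reflect_braid_6[OF form_e_self form_e_self, of i j] sq 4 show ?thesis
      by (simp add: coxeter_exponent_def numeral_eq_Suc reflect_reflect)
  qed
qed

text \<open>By the relations just verified, the action of words descends to the group.\<close>

lemma act_cong:
  assumes "elt u = elt v"
  shows "act u x = act v x"
proof -
  have "act (map fst u) x = act (map fst v) x" if "pres_eq (coxeter_relators Q) u v" for u v x
    using that
  proof (induction arbitrary: x rule: pres_eq.induct)
    case (relator r)
    have "map fst (concat (replicate n [(i, True), (j, True)])) =
        concat (replicate n [i, j])" for n and i j :: 'v
      by (induction n) auto
    with relator show ?case
      by (auto simp: coxeter_relators_def act_coxeter_relation reflect_reflect)
  qed (simp_all add: act_append reflect_reflect)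
  from this[of "map (\<lambda>i. (i, True)) u" "map (\<lambda>i. (i, True)) v" x] assms show ?thesis
    by (simp add: elt_def pres_class_eq_iff comp_def)
qed

end

section \<open>Roots are positive or negative\<close>

context weyl_quiver
begin

text \<open>The length of the group element given by \<open>u\<close>, not of the word.\<close>

definition len :: "'v list \<Rightarrow> nat" where
  "len u = (LEAST n. \<exists>v. elt v = elt u \<and> length v = n)"

lemma reduced_word: obtains v where "elt v = elt u" "length v = len u"
proof -
  have "\<exists>v. elt v = elt u \<and> length v = len u"
    unfolding len_def by (rule LeastI_ex) blast
  then show thesis using that by blast
qed

lemma len_le: "elt v = elt u \<Longrightarrow> len u \<le> length v"
  unfolding len_def by (rule Least_le) blast

lemma len_cong: "elt u = elt v \<Longrightarrow> len u = len v"
  by (simp add: len_def)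

lemma len_append_le: "len (u @ v) \<le> len u + length v"
proof -
  obtain u' where "elt u' = elt u" "length u' = len u" by (rule reduced_word)
  then show ?thesis using len_le[of "u' @ v" "u @ v"] by (simp add: elt_append)
qed

lemma len_le_snoc: "len u \<le> Suc (len (u @ [i]))"
  using len_append_le[of "u @ [i]" "[i]"] len_cong[OF elt_cancel_pair[of u i "[]"]] by simp

subsection \<open>Alternating words in two letters\<close>

text \<open>The words are built from the right and end in \<open>t\<close>, because they are split off from the right
  of other words.\<close>

primrec alternating :: "'v \<Rightarrow> 'v \<Rightarrow> nat \<Rightarrow> 'v list" where
  "alternating s t 0 = []"
| "alternating s t (Suc k) = (if even k then t else s) # alternating s t k"

lemma length_alternating [simp]: "length (alternating s t k) = k"
  by (induction k) auto

lemma alternating_add: "\<exists>p. length p = j \<and> alternating s t (j + k) = p @ alternating s t k"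
proof (induction j)
  case (Suc j)
  then obtain p where "length p = j" "alternating s t (j + k) = p @ alternating s t k" by blast
  then show ?case by (intro exI[of _ "(if even (j + k) then t else s) # p"]) simp
qed simp

lemma alternating_explicit:
  "alternating s t 2 = [s, t]" "alternating s t 3 = [t, s, t]"
  "alternating s t 4 = [s, t, s, t]" "alternating s t 6 = [s, t, s, t, s, t]"
proof -
  have "alternating s t (Suc (Suc 0)) = [s, t]" "alternating s t (Suc (Suc (Suc 0))) = [t, s, t]"
    "alternating s t (Suc (Suc (Suc (Suc 0)))) = [s, t, s, t]"
    "alternating s t (Suc (Suc (Suc (Suc (Suc (Suc 0)))))) = [s, t, s, t, s, t]"
    by simp_all
  then show "alternating s t 2 = [s, t]" "alternating s t 3 = [t, s, t]"
    "alternating s t 4 = [s, t, s, t]" "alternating s t 6 = [s, t, s, t, s, t]"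
    by (simp_all add: numeral_eq_Suc del: alternating.simps)
qed

text \<open>By the braid relation an alternating word of the length of the Coxeter exponent can be made to
  end in the other letter, which limits the length of an alternating right factor of a word that is
  not shortened by that letter.\<close>

lemma elt_alternating_exponent:
  assumes "s \<noteq> t"
  shows "\<exists>p. Suc (length p) = coxeter_exponent Q s t \<and>
           elt (alternating s t (coxeter_exponent Q s t)) = elt (p @ [s])"
proof (cases s t rule: edge_weight_cases)
  case 1
  then have "elt ([s, t] @ [s, t]) = elt []"
    using elt_coxeter_relation[OF assms] by (simp add: coxeter_exponent_def numeral_eq_Suc)
  from elt_eq_rev[OF this] 1 show ?thesis
    by (intro exI[of _ "[t]"]) (simp add: coxeter_exponent_def alternating_explicit)
next
  case 2
  then have "elt ([s, t, s] @ [t, s, t]) = elt []"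
    using elt_coxeter_relation[OF assms] by (simp add: coxeter_exponent_def numeral_eq_Suc)
  from elt_eq_rev[OF this] 2 show ?thesis
    by (intro exI[of _ "[s, t]"]) (simp add: coxeter_exponent_def alternating_explicit)
next
  case 3
  then have "elt ([s, t, s, t] @ [s, t, s, t]) = elt []"
    using elt_coxeter_relation[OF assms] by (simp add: coxeter_exponent_def numeral_eq_Suc)
  from elt_eq_rev[OF this] 3 show ?thesis
    by (intro exI[of _ "[t, s, t]"]) (simp add: coxeter_exponent_def alternating_explicit)
next
  case 4
  then have "elt ([s, t, s, t, s, t] @ [s, t, s, t, s, t]) = elt []"
    using elt_coxeter_relation[OF assms] by (simp add: coxeter_exponent_def numeral_eq_Suc)
  from elt_eq_rev[OF this] 4 show ?thesis
    by (intro exI[of _ "[t, s, t, s, t]"]) (simp add: coxeter_exponent_def alternating_explicit)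
qed

text \<open>With \<open>a = sqrt c\<close> the two reflections act on the coordinates alternately by
  \<open>y \<mapsto> a x - y\<close> and \<open>x \<mapsto> a y - x\<close>. Starting from \<open>(1, 0)\<close> the coordinates are values
  \<open>sin (k \<pi> / m) / sin (\<pi> / m)\<close>, which stay nonnegative for fewer than \<open>m\<close> steps.\<close>

lemma act_alternating_nonneg:
  assumes "s \<noteq> t" "k < coxeter_exponent Q s t"
  shows "\<exists>x y. 0 \<le> x \<and> 0 \<le> y \<and> act (alternating s t k) (e s) = x *\<^sub>R e s + y *\<^sub>R e t"
proof -
  define a where "a = sqrt (edge_weight Q s t)"
  have "form (e s) (e t) = - a" "form (e t) (e s) = - a"
    using assms(1) by (simp_all add: form_e_e cartan_def a_def edge_weight_sym)
  then have t: "reflect (e t) (x *\<^sub>R e s + y *\<^sub>R e t) = x *\<^sub>R e s + (a * x - y) *\<^sub>R e t"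
    and s: "reflect (e s) (x *\<^sub>R e s + y *\<^sub>R e t) = (a * y - x) *\<^sub>R e s + y *\<^sub>R e t" for x y
    by (simp_all add: reflect_def form_simps vec_eq_iff algebra_simps)
  have 0: "act (alternating s t 0) (e s) = 1 *\<^sub>R e s + 0 *\<^sub>R e t" by simp
  have step_t: "act (alternating s t (Suc k)) (e s) = x *\<^sub>R e s + (a * x - y) *\<^sub>R e t"
    if "even k" "act (alternating s t k) (e s) = x *\<^sub>R e s + y *\<^sub>R e t" for k x y
    using that by (simp add: t)
  have step_s: "act (alternating s t (Suc k)) (e s) = (a * y - x) *\<^sub>R e s + y *\<^sub>R e t"
    if "odd k" "act (alternating s t k) (e s) = x *\<^sub>R e s + y *\<^sub>R e t" for k x y
    using that by (simp add: s)
  have parity: "even (0::nat)" "odd (Suc 0)" "even (Suc (Suc 0))" "odd (Suc (Suc (Suc 0)))"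
      "even (Suc (Suc (Suc (Suc 0))))"
    by simp_all
  note 1 = step_t[OF parity(1) 0]
  note 2 = step_s[OF parity(2) 1]
  note 3 = step_t[OF parity(3) 2]
  note 4 = step_s[OF parity(4) 3]
  note 5 = step_t[OF parity(5) 4]
  have a: "0 \<le> a" "a * a = edge_weight Q s t" by (simp_all add: a_def)
  then have a': "a * (a * z) = edge_weight Q s t * z" for z by (simp flip: mult.assoc)
  have intro: ?thesis if "act (alternating s t n) (e s) = x *\<^sub>R e s + y *\<^sub>R e t" "k = n" "0 \<le> x" "0 \<le> y" for n x y
    using that by blast
  show ?thesis
  proof (cases s t rule: edge_weight_cases)
    case c: 1
    with assms have "k = 0 \<or> k = Suc 0" by (auto simp: coxeter_exponent_def)
    then show ?thesis
      by (elim disjE) ((rule intro[OF 0] intro[OF 1], assumption,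
        use a c in \<open>simp add: algebra_simps a'\<close>,
        use a c in \<open>simp add: algebra_simps a'\<close>)+)
  next
    case c: 2
    with assms have "k = 0 \<or> k = Suc 0 \<or> k = Suc (Suc 0)" by (auto simp: coxeter_exponent_def)
    then show ?thesis
      by (elim disjE) ((rule intro[OF 0] intro[OF 1] intro[OF 2], assumption,
        use a c in \<open>simp add: algebra_simps a'\<close>,
        use a c in \<open>simp add: algebra_simps a'\<close>)+)
  next
    case c: 3
    with assms have "k = 0 \<or> k = Suc 0 \<or> k = Suc (Suc 0) \<or> k = Suc (Suc (Suc 0))"
      by (auto simp: coxeter_exponent_def)
    then show ?thesis
      by (elim disjE) ((rule intro[OF 0] intro[OF 1] intro[OF 2] intro[OF 3], assumption,
        use a c in \<open>simp add: algebra_simps a'\<close>,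
        use a c in \<open>simp add: algebra_simps a'\<close>)+)
  next
    case c: 4
    with assms have "k = 0 \<or> k = Suc 0 \<or> k = Suc (Suc 0) \<or> k = Suc (Suc (Suc 0))
        \<or> k = Suc (Suc (Suc (Suc 0))) \<or> k = Suc (Suc (Suc (Suc (Suc 0))))"
      by (auto simp: coxeter_exponent_def)
    then show ?thesis
      by (elim disjE) ((rule intro[OF 0] intro[OF 1] intro[OF 2] intro[OF 3] intro[OF 4] intro[OF 5], assumption,
        use a c in \<open>simp add: algebra_simps a'\<close>,
        use a c in \<open>simp add: algebra_simps a'\<close>)+)
  qed
qed

text \<open>Suppose that \<open>s\<close> does not shorten \<open>u\<close>, and let \<open>t\<close> be the last letter of a reduced word of \<open>u\<close>.
  Split \<open>u\<close>, without increasing the length, into \<open>v\<close> and an alternating word in \<open>s\<close> and \<open>t\<close>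
  that is as long as possible. Then neither \<open>s\<close> nor \<open>t\<close> shortens \<open>v\<close>, so that \<open>v\<close> maps \<open>e s\<close> and
  \<open>e t\<close> to nonnegative vectors by induction; and the alternating word is shorter than the Coxeter
  exponent, as otherwise it could be made to end in \<open>s\<close>. So it maps \<open>e s\<close> to a
  nonnegative combination of \<open>e s\<close> and \<open>e t\<close>.\<close>

theorem act_simple_nonneg:
  assumes "len u \<le> len (u @ [s])"
  shows "0 \<le> act u (e s)"
  using assms
proof (induction "len u" arbitrary: u s rule: less_induct)
  case less
  obtain r where r: "elt r = elt u" "length r = len u" by (rule reduced_word)
  show ?case
  proof (cases r rule: rev_cases)
    case Nil
    then have "act u (e s) = e s" using act_cong[OF r(1), of "e s"] by simp
    then show ?thesis by (simp add: less_eq_vec_def axis_def)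
  next
    case (snoc r1 t)
    have "s \<noteq> t"
    proof
      assume "s = t"
      then have "elt (u @ [s]) = elt r1"
        using elt_cong[OF r(1) HOL.refl, of "[s]"] elt_cancel_pair[of r1 s "[]"] snoc by simp
      then have "len (u @ [s]) \<le> length r1" by (intro len_le) simp
      then show False using less.prems r(2) snoc by simp
    qed
    define P where "P k \<longleftrightarrow> (\<exists>v. elt u = elt (v @ alternating s t k) \<and> len v + k = len u)" for k
    have "P 1"
    proof -
      have "len u \<le> len r1 + 1" using len_append_le[of r1 "[t]"] len_cong[OF r(1)] snoc by simp
      moreover have "len r1 \<le> length r1" by (rule len_le) simp
      ultimately show ?thesis using r snoc unfolding P_def by (intro exI[of _ r1]) simp
    qed
    moreover have "k \<le> len u" if "P k" for k using that by (auto simp: P_def)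
    ultimately obtain k where k: "P k" "\<And>k'. P k' \<Longrightarrow> k' \<le> k"
      using GreatestI_nat[of P 1 "len u"] Greatest_le_nat[of P _ "len u"] by blast
    have "1 \<le> k" by (rule k(2)) fact
    then obtain k' where k': "k = Suc k'" by (cases k) auto
    obtain v where v: "elt u = elt (v @ alternating s t k)" "len v + k = len u"
      using k(1) by (auto simp: P_def)
    have "k < coxeter_exponent Q s t"
    proof (rule ccontr)
      let ?m = "coxeter_exponent Q s t"
      assume "\<not> k < ?m"
      then obtain j where j: "k = j + ?m" by (metis add.commute le_Suc_ex not_less)
      obtain p where p: "length p = j" "alternating s t k = p @ alternating s t ?m"
        using alternating_add[of j s t ?m] j by auto
      obtain q where q: "Suc (length q) = ?m" "elt (alternating s t ?m) = elt (q @ [s])"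
        using elt_alternating_exponent[OF \<open>s \<noteq> t\<close>] by blast
      have "elt (u @ [s]) = elt ((v @ p @ q) @ s # s # [])"
        using v(1) p(2) q(2) elt_append[of "[s]" "[s]"] by (simp add: elt_append W.m_assoc)
      then have "elt (u @ [s]) = elt (v @ p @ q)" using elt_cancel_pair[of "v @ p @ q" s "[]"] by simp
      then have "len (u @ [s]) \<le> len v + length (p @ q)"
        using len_append_le[of v "p @ q"] len_cong[of "u @ [s]" "v @ p @ q"] by simp
      then show False using less.prems v(2) p(1) q(1) j by simp
    qed
    then obtain x y where xy: "0 \<le> x" "0 \<le> y"
        "act (alternating s t k) (e s) = x *\<^sub>R e s + y *\<^sub>R e t"
      using act_alternating_nonneg[OF \<open>s \<noteq> t\<close>] by blast
    let ?p = "if even k' then t else s" and ?q = "if even k then t else s"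
    have "len v \<le> len (v @ [?p])"
    proof -
      have "elt u = elt ((v @ [?p]) @ alternating s t k')" using v(1) k' by simp
      from len_cong[OF this] have "len u \<le> len (v @ [?p]) + k'"
        using len_append_le[of "v @ [?p]" "alternating s t k'"] by simp
      then show ?thesis using v(2) k' by simp
    qed
    moreover have "len v \<le> len (v @ [?q])"
    proof (rule ccontr)
      assume "\<not> len v \<le> len (v @ [?q])"
      then have "len (v @ [?q]) + Suc k = len u" using len_le_snoc[of v ?q] v(2) by linarith
      moreover have "elt u = elt ((v @ [?q]) @ alternating s t (Suc k))"
        using v(1) elt_cancel_pair[of v ?q "alternating s t k"] by simp
      ultimately have "P (Suc k)" unfolding P_def by blast
      with k(2)[of "Suc k"] show False by simp
    qed
    ultimately have "len v \<le> len (v @ [s])" "len v \<le> len (v @ [t])"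
      using k' by (auto split: if_splits)
    then have "0 \<le> act v (e s)" "0 \<le> act v (e t)"
      using less.hyps[of v] v(2) k' by auto
    moreover have "act u (e s) = x *\<^sub>R act v (e s) + y *\<^sub>R act v (e t)"
      using act_cong[OF v(1), of "e s"] xy(3) by (simp add: act_append act_add act_scale)
    ultimately show ?thesis using xy(1,2) by (simp add: less_eq_vec_def)
  qed
qed

lemma act_simple_nonneg_or_nonpos: "0 \<le> act u (e s) \<or> act u (e s) \<le> 0"
proof (cases "len u \<le> len (u @ [s])")
  case True
  then show ?thesis using act_simple_nonneg by blast
next
  case False
  then have "len (u @ [s]) \<le> len ((u @ [s]) @ [s])"
    using len_cong[OF elt_cancel_pair[of u s "[]"]] by simp
  then have "0 \<le> act (u @ [s]) (e s)" by (rule act_simple_nonneg)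
  then have "0 \<le> - act u (e s)" by (simp add: act_append reflect_self act_uminus)
  then show ?thesis by (simp add: less_eq_vec_def)
qed

text \<open>The geometric representation is faithful: a nontrivial element has a reduced word, and
  maps the simple root of its last letter to a nonpositive vector.\<close>

lemma elt_eq_Nil_if_act_trivial:
  assumes "\<And>x. act u x = x"
  shows "elt u = elt []"
proof -
  obtain r where r: "elt r = elt u" "length r = len u" by (rule reduced_word)
  show ?thesis
  proof (cases r rule: rev_cases)
    case Nil
    then show ?thesis using r by simp
  next
    case (snoc r1 t)
    have "len r1 \<le> length r1" by (rule len_le) simp
    also have "\<dots> \<le> len (r1 @ [t])" using len_cong[OF r(1)] r(2) snoc by simp
    finally have "0 \<le> act r1 (e t)" by (rule act_simple_nonneg)
    moreover have "e t = - act r1 (e t)"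
      using act_cong[OF r(1), of "e t"] assms snoc by (simp add: act_append reflect_self act_uminus)
    ultimately have "e t $ t = - act r1 (e t) $ t" "0 \<le> act r1 (e t) $ t"
      by (simp_all add: less_eq_vec_def flip: vector_uminus_component)
    then show ?thesis by simp
  qed
qed

lemma elt_eqI:
  assumes "\<And>x. act u x = act v x"
  shows "elt u = elt v"
proof -
  have "elt (rev v @ u) = elt []"
    by (rule elt_eq_Nil_if_act_trivial) (simp add: act_append assms act_rev_cancel)
  from elt_cong[OF HOL.refl this, of v] elt_cong[OF elt_rev_cancel[of "rev v"] HOL.refl, of u]
  show ?thesis by simp
qed

end

section \<open>Realising conjugations by mutations\<close>

context weyl_quiver
begin

text \<open>At a sink \<open>k\<close> mutation conjugates all attached elements by the one attached to \<open>k\<close>, because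
  the elements at vertices not joined to \<open>k\<close> commute with it. If \<open>k\<close>
  has been made a source before, mutating there once makes it a sink at no cost; so \<open>w k\<close> can be
  reached from \<open>w\<close>.\<close>

theorem mutation_seq_conjugation:
  assumes "one_lower_neighbour f Q"
  shows "\<exists>ks Q'. mutation_seq (weyl_group Q) ks Q (simple_reflection Q) Q' (\<lambda>i. elt (w @ [i] @ rev w)) \<and>
           is_quiver Q' \<and> edge_weight Q' = edge_weight Q"
proof (induction w rule: rev_induct)
  case Nil
  have "simple_reflection Q = (\<lambda>i. elt ([] @ [i] @ rev []))"
    by (simp add: fun_eq_iff simple_reflection_elt)
  then show ?case using quiver mutation_seq.Nil by metis
next
  case (snoc k w)
  let ?x = "\<lambda>i. elt (w @ [i] @ rev w)"
  let ?x' = "\<lambda>i. elt ((w @ [k]) @ [i] @ rev (w @ [k]))"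
  obtain ks Q' where Q': "mutation_seq (weyl_group Q) ks Q (simple_reflection Q) Q' ?x"
      "is_quiver Q'" "edge_weight Q' = edge_weight Q"
    using snoc by blast
  have "one_lower_neighbour f Q'" using assms Q'(3) by (simp add: one_lower_neighbour_def)
  then obtain ls Q1 where Q1: "mutation_seq (weyl_group Q) ls Q' ?x Q1 ?x"
      "is_quiver Q1" "edge_weight Q1 = edge_weight Q'" and source: "\<And>i. Q1 i k = 0"
    using mutate_to_source[OF Q'(2)] by blast
  let ?Q2 = "flip_at k Q1"
  let ?Q3 = "flip_at k ?Q2"
  have "mutation_seq (weyl_group Q) (ks @ ls) Q (simple_reflection Q) Q1 ?x"
    using Q'(1) Q1(1) by (rule mutation_seq_append)
  from mutation_seq_snoc[OF this quiver_mutation_source_or_sink[OF Q1(2), of k]]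
  have "mutation_seq (weyl_group Q) ((ks @ ls) @ [k]) Q (simple_reflection Q) ?Q2 ?x"
    using source by (simp add: mutate_attached_source)
  moreover have sink: "?Q2 k i = 0" for i using source by (simp add: flip_at_def)
  ultimately have "mutation_seq (weyl_group Q) (((ks @ ls) @ [k]) @ [k]) Q (simple_reflection Q) ?Q3
      (mutate_attached (weyl_group Q) k ?Q2 ?x)"
    using is_quiver_flip_at[OF Q1(2)] by (intro mutation_seq_snoc quiver_mutation_source_or_sink) auto
  moreover have "mutate_attached (weyl_group Q) k ?Q2 ?x = ?x'"
  proof
    fix i
    show "mutate_attached (weyl_group Q) k ?Q2 ?x i = ?x' i"
    proof (cases "?Q2 i k > 0")
      case True
      have "elt ((w @ [k] @ rev w) @ (w @ [i] @ rev w) @ (w @ [k] @ rev w)) = ?x' i"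
        by (rule elt_eqI) (simp add: act_append act_rev_cancel)
      then show ?thesis using True by (simp add: mutate_attached_def W.m_assoc flip: elt_append)
    next
      case False
      then have "edge_weight ?Q2 i k = 0" 
        using sink unfolding edge_weight_def by simp
      then have "edge_weight Q i k = 0" using Q1(3) Q'(3) by simp
      then have "i = k \<or> form (e i) (e k) = 0" by (simp add: form_e_e cartan_def)
      then have "reflect (e k) (reflect (e i) (reflect (e k) y)) = reflect (e i) y" for y
        using reflect_commute[of "e i" "e k"] by (auto simp: reflect_reflect)
      then have "?x i = ?x' i" by (intro elt_eqI) (simp add: act_append)
      then show ?thesis using False by (simp add: mutate_attached_def)
    qed
  qed
  ultimately show ?case using is_quiver_flip_at[OF is_quiver_flip_at[OF Q1(2)]] Q1(3) Q'(3) by (metis edge_weight_flip_at)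
qed

lemma attached_elements_reflections:
  assumes "mutation_seq (weyl_group Q) ks Q1 x Q' x'" and "\<And>i. x i \<in> reflections Q"
  shows "x' i \<in> reflections Q"
  using assms
proof (induction arbitrary: i rule: mutation_seq.induct)
  case (Cons k Q1 Q2 ks x Q' x')
  have "x k \<otimes>\<^bsub>weyl_group Q\<^esub> x j \<otimes>\<^bsub>weyl_group Q\<^esub> x k \<in> reflections Q" for j
  proof -
    obtain u a v b where "x k = elt (u @ [a] @ rev u)" "x j = elt (v @ [b] @ rev v)"
      using Cons.prems[of k] Cons.prems[of j] unfolding reflections_elt by auto
    then have "x k \<otimes>\<^bsub>weyl_group Q\<^esub> x j \<otimes>\<^bsub>weyl_group Q\<^esub> x k =
        elt ((u @ [a] @ rev u @ v) @ [b] @ rev (u @ [a] @ rev u @ v))"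
      by (simp add: W.m_assoc flip: elt_append)
    then show ?thesis unfolding reflections_elt by blast
  qed
  then have "mutate_attached (weyl_group Q) k Q1 x j \<in> reflections Q" for j
    using Cons.prems by (simp add: mutate_attached_def)
  then show ?case by (rule Cons.IH)
qed simp

end

section \<open>Dynkin diagrams\<close>

lemma dynkin_edge_le_3: "dynkin_edge \<Gamma> i j \<le> 3"
  by (cases \<Gamma>) (auto simp: dynkin_edge_def)

lemma dynkin_edge_lower_neighbour:
  assumes "is_dynkin \<Gamma>" "a < c" "b < c" "dynkin_edge \<Gamma> a c > 0" "dynkin_edge \<Gamma> b c > 0"
  shows "a = b"
  using assms by (cases \<Gamma>) (auto simp: dynkin_edge_def split: if_splits)

text \<open>A vector that strictly exceeds at every node half of the weighted sum over the neighbours. It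
  has positive inner product with all simple roots, and its mere existence
  makes the invariant form positive definite.\<close>

definition superharmonic_weights :: "dynkin_type \<Rightarrow> (nat \<Rightarrow> real) \<Rightarrow> bool" where
  "superharmonic_weights \<Gamma> u \<longleftrightarrow>
     (\<forall>i<dynkin_rank \<Gamma>. 0 < u i \<and> (\<Sum>j<dynkin_rank \<Gamma>. sqrt (dynkin_edge \<Gamma> i j) * u j) < 2 * u i)"

lemma sum_path:
  fixes p u :: "nat \<Rightarrow> real"
  assumes "i < n"
  shows "(\<Sum>j<n. ((if j = Suc i then p i else 0) + (if i = Suc j then p j else 0)) * u j) =
    (if Suc i < n then p i * u (Suc i) else 0) + (if 0 < i then p (i - 1) * u (i - 1) else 0)"
proof -
  have "(\<Sum>j<n. (if i = Suc j then p j else 0) * u j) =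
      (\<Sum>j<n. if j = i - 1 then (if 0 < i then p (i - 1) * u (i - 1) else 0) else 0)"
    by (intro sum.cong) auto
  also have "\<dots> = (if 0 < i then p (i - 1) * u (i - 1) else 0)"
    using assms by auto
  moreover have "(\<Sum>j<n. (if j = Suc i then p i else 0) * u j) =
      (\<Sum>j<n. if j = Suc i then p i * u j else 0)"
    by (intro sum.cong) auto
  ultimately show ?thesis by (simp add: distrib_right sum.distrib)
qed

text \<open>On a path superharmonic means strictly concave. This sequence is moreover increasing up to \<open>n\<close>, so that the
  path may end at \<open>n - 1\<close> as it does in type \<open>A\<close>. The ends of types \<open>B\<close> and \<open>D\<close> are obtained by
  folding: the last value is divided by \<open>sqrt 2\<close>, or by \<open>2\<close> and given to both tips of the fork.\<close>

definition parabola :: "nat \<Rightarrow> nat \<Rightarrow> real" where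
  "parabola n i = (real i + 1) * (2 * real n - real i)"

lemma parabola_pos: "i < n \<Longrightarrow> 0 < parabola n i"
  by (simp add: parabola_def)

lemma parabola_0: "parabola n 1 < 2 * parabola n 0"
  by (simp add: parabola_def algebra_simps)

lemma parabola_concave: "parabola n (Suc (Suc i)) + parabola n i < 2 * parabola n (Suc i)"
  by (simp add: parabola_def algebra_simps)

lemma parabola_less: "Suc i < n \<Longrightarrow> parabola n i < parabola n (Suc i)"
  by (simp add: parabola_def algebra_simps)

lemma superharmonic_A:
  assumes "n \<ge> 1"
  shows "superharmonic_weights (Dyn_A n) (parabola n)"
  unfolding superharmonic_weights_def dynkin_rank.simps
proof (intro allI impI conjI)
  fix i assume i: "i < n"
  have "(\<Sum>j<n. sqrt (dynkin_edge (Dyn_A n) i j) * parabola n j) =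
      (\<Sum>j<n. ((if j = Suc i then 1 else 0) + (if i = Suc j then 1 else 0)) * parabola n j)"
    by (intro sum.cong) (auto simp: dynkin_edge_def min_def max_def)
  also have "\<dots> = (if Suc i < n then parabola n (Suc i) else 0) + (if 0 < i then parabola n (i - 1) else 0)"
    using sum_path[OF i, of "\<lambda>_. 1"] by simp
  also have "\<dots> < 2 * parabola n i"
    using i parabola_pos[of i n] parabola_0[of n] parabola_concave[of n "i - 1"] parabola_less[of "i - 1" n]
    by (cases i) auto
  finally show "(\<Sum>j<n. sqrt (dynkin_edge (Dyn_A n) i j) * parabola n j) < 2 * parabola n i" .
qed (rule parabola_pos)

lemma superharmonic_B:
  assumes "n \<ge> 2" and \<Gamma>: "\<Gamma> = Dyn_B n \<or> \<Gamma> = Dyn_C n"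
  shows "superharmonic_weights \<Gamma> (\<lambda>i. if Suc i = n then parabola n i / sqrt 2 else parabola n i)"
    (is "superharmonic_weights _ ?u")
proof -
  have rank: "dynkin_rank \<Gamma> = n" using \<Gamma> by auto
  let ?p = "\<lambda>i. if Suc (Suc i) = n then sqrt 2 else 1 :: real"
  show ?thesis
    unfolding superharmonic_weights_def rank
  proof (intro allI impI conjI)
    fix i assume i: "i < n"
    show "0 < ?u i" using parabola_pos[OF i] by simp
    have "(\<Sum>j<n. sqrt (dynkin_edge \<Gamma> i j) * ?u j) =
        (\<Sum>j<n. ((if j = Suc i then ?p i else 0) + (if i = Suc j then ?p j else 0)) * ?u j)"
      using \<Gamma> by (intro sum.cong) (auto simp: dynkin_edge_def min_def max_def)
    also have "\<dots> = (if Suc i < n then parabola n (Suc i) else 0)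
        + (if 0 < i then (if Suc i = n then sqrt 2 else 1) * parabola n (i - 1) else 0)"
      using sum_path[OF i, of ?p ?u] i by (auto simp: real_div_sqrt)
    also have "\<dots> < 2 * ?u i"
    proof (cases "Suc i = n")
      case True
      have "sqrt 2 * parabola n (i - 1) < sqrt 2 * parabola n i"
        using parabola_less[of "i - 1" n] True assms(1) by simp
      also have "\<dots> = 2 * (parabola n i / sqrt 2)" by (simp add: field_simps)
      finally show ?thesis using True assms(1) by simp
    next
      case False
      then show ?thesis
        using i parabola_pos[of i n] parabola_0[of n] parabola_concave[of n "i - 1"]
        by (cases i) auto
    qed
    finally show "(\<Sum>j<n. sqrt (dynkin_edge \<Gamma> i j) * ?u j) < 2 * ?u i" .
  qed
qed

lemma dynkin_edge_D:
  assumes "n \<ge> 4"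
  shows "dynkin_edge (Dyn_D n) i j =
    (if j = Suc i \<and> Suc j < n \<or> i = Suc j \<and> Suc i < n \<or> i + 3 = n \<and> Suc j = n \<or> j + 3 = n \<and> Suc i = n
     then 1 else 0)"
  using assms by (cases "i \<le> j") (auto simp: dynkin_edge_def min_def max_def)

lemma sum_dynkin_edge_D:
  fixes u :: "nat \<Rightarrow> real"
  assumes "n \<ge> 4" "i < n"
  shows "(\<Sum>j<n. sqrt (dynkin_edge (Dyn_D n) i j) * u j) =
    (if i + 2 < n then u (Suc i) else 0) + (if 0 < i \<and> Suc i < n then u (i - 1) else 0)
      + (if i + 3 = n then u (n - 1) else 0) + (if Suc i = n then u (n - 3) else 0)"
proof -
  let ?p = "\<lambda>i. if i + 2 < n then 1 else 0 :: real"
  obtain m where n: "n = Suc (Suc (Suc (Suc m)))"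
    using le_Suc_ex[OF assms(1)] by (auto simp: numeral_eq_Suc)
  have edge: "sqrt (dynkin_edge (Dyn_D n) i j) = (if j = Suc i then ?p i else 0) + (if i = Suc j then ?p j else 0)
      + (if j = n - 1 then (if i + 3 = n then 1 else 0) else 0)
      + (if j = n - 3 then (if Suc i = n then 1 else 0) else 0)" if "j < n" for j
  proof -
    consider "j = Suc i" | "i = Suc j" | "i + 3 = n" "Suc j = n" | "j + 3 = n" "Suc i = n"
      | "j \<noteq> Suc i" "i \<noteq> Suc j" "\<not> (i + 3 = n \<and> Suc j = n)" "\<not> (j + 3 = n \<and> Suc i = n)" by blast
    then show ?thesis
    proof cases
      case 1
      then show ?thesis using that n assms(2) unfolding dynkin_edge_D[OF assms(1)] by simp
    next
      case 2
      then show ?thesis using that n assms(2) unfolding dynkin_edge_D[OF assms(1)] by simp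
    next
      case 3
      then show ?thesis using that n assms(2) unfolding dynkin_edge_D[OF assms(1)] by simp
    next
      case 4
      then show ?thesis using that n assms(2) unfolding dynkin_edge_D[OF assms(1)] by simp
    next
      case 5
      then show ?thesis using that n assms(2) unfolding dynkin_edge_D[OF assms(1)] by auto
    qed
  qed
  have "(\<Sum>j<n. sqrt (dynkin_edge (Dyn_D n) i j) * u j) =
      (\<Sum>j<n. ((if j = Suc i then ?p i else 0) + (if i = Suc j then ?p j else 0)) * u j
         + (if j = n - 1 then (if i + 3 = n then u j else 0) else 0)
         + (if j = n - 3 then (if Suc i = n then u j else 0) else 0))"
    by (intro sum.cong)
      (simp_all only: edge lessThan_iff distrib_right if_distrib[of "\<lambda>c. c * _"] mult_1 mult_zero_left
        cong: if_cong)
  also have "\<dots> = (if Suc i < n then ?p i * u (Suc i) else 0) + (if 0 < i then ?p (i - 1) * u (i - 1) else 0)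
      + (if i + 3 = n then u (n - 1) else 0) + (if Suc i = n then u (n - 3) else 0)"
    using assms unfolding sum.distrib sum_path[OF assms(2), of ?p u] by simp
  also have "\<dots> = (if i + 2 < n then u (Suc i) else 0) + (if 0 < i \<and> Suc i < n then u (i - 1) else 0)
      + (if i + 3 = n then u (n - 1) else 0) + (if Suc i = n then u (n - 3) else 0)"
    by (cases i) auto
  finally show ?thesis .
qed

lemma superharmonic_D:
  assumes "n \<ge> 4"
  shows "superharmonic_weights (Dyn_D n) (\<lambda>i. if n \<le> i + 2 then parabola n (n - 2) / 2 else parabola n i)"
    (is "superharmonic_weights _ ?u")
  unfolding superharmonic_weights_def dynkin_rank.simps
proof (intro allI impI conjI)
  fix i assume i: "i < n"
  show "0 < ?u i" using parabola_pos[of i n] parabola_pos[of "n - 2" n] i assms by simp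
  have "(\<Sum>j<n. sqrt (dynkin_edge (Dyn_D n) i j) * ?u j) =
    (if i + 2 < n then ?u (Suc i) else 0) + (if 0 < i \<and> Suc i < n then ?u (i - 1) else 0)
      + (if i + 3 = n then ?u (n - 1) else 0) + (if Suc i = n then ?u (n - 3) else 0)"
    by (rule sum_dynkin_edge_D) fact+
  also have "\<dots> < 2 * ?u i"
  proof -
    consider "i = 0" | "0 < i" "i + 3 < n" | "i + 3 = n" | "i + 2 = n" | "i + 1 = n" using i by linarith
    then show ?thesis
    proof cases
      case 1
      then show ?thesis using parabola_0[of n] assms by simp
    next
      case 2
      then show ?thesis using parabola_concave[of n "i - 1"] by (cases i) auto
    next
      case 3
      then show ?thesis using parabola_concave[of n "i - 1"] assms by (cases i) auto
    next
      case 4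
      then show ?thesis using parabola_less[of "i - 1" n] assms by (cases i) auto
    next
      case 5
      then have "n - 3 = i - 2" "n - 2 = Suc (i - 2)" using assms by auto
      then show ?thesis using parabola_less[of "i - 2" n] 5 assms by auto
    qed
  qed
  finally show "(\<Sum>j<n. sqrt (dynkin_edge (Dyn_D n) i j) * ?u j) < 2 * ?u i" .
qed

text \<open>For \<open>E\<^sub>8\<close> the values are the coefficients of the sum of all positive roots; cutting off nodes at
  the end of the long arm leaves a superharmonic vector. The values for \<open>F\<^sub>4\<close> and \<open>G\<^sub>2\<close> arise in
  the same way, rescaled to simple roots of equal length.\<close>

lemma superharmonic_E:
  assumes "n \<in> {6, 7, 8}"
  shows "superharmonic_weights (Dyn_E n)
    (\<lambda>i. if Suc i = n then 136 else [92, 182, 270, 220, 168, 114, 58] ! i)"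
proof -
  consider "n = 6" | "n = 7" | "n = 8" using assms by auto
  then show ?thesis
    by cases (simp_all add: superharmonic_weights_def dynkin_edge_def numeral_eq_Suc lessThan_Suc All_less_Suc)
qed

lemma superharmonic_F4:
  "superharmonic_weights Dyn_F4 (\<lambda>i. [16, 30, 21 * sqrt 2, 11 * sqrt 2] ! i)"
proof -
  have *: "sqrt 2 * (21 * sqrt 2) = (42 :: real)" by simp
  show ?thesis
    by (simp add: * superharmonic_weights_def dynkin_edge_def numeral_eq_Suc lessThan_Suc All_less_Suc)
qed

lemma superharmonic_G2:
  "superharmonic_weights Dyn_G2 (\<lambda>i. [10, 6 * sqrt 3] ! i)"
  by (simp add: superharmonic_weights_def dynkin_edge_def numeral_eq_Suc lessThan_Suc All_less_Suc)

lemma superharmonic_weights_exist: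
  assumes "is_dynkin \<Gamma>"
  shows "\<exists>u. superharmonic_weights \<Gamma> u"
proof (cases \<Gamma>)
  case (Dyn_A n)
  then show ?thesis using assms superharmonic_A[of n] by auto
next
  case (Dyn_B n)
  then show ?thesis using assms superharmonic_B[of n \<Gamma>] by auto
next
  case (Dyn_C n)
  then show ?thesis using assms superharmonic_B[of n \<Gamma>] by auto
next
  case (Dyn_D n)
  then show ?thesis using assms superharmonic_D[of n] by auto
next
  case (Dyn_E n)
  then show ?thesis using assms superharmonic_E[of n] by auto
next
  case Dyn_F4
  then show ?thesis using superharmonic_F4 by auto
next
  case Dyn_G2
  then show ?thesis using superharmonic_G2 by auto
qed

section \<open>Automorphisms that preserve reflections\<close>

text \<open>What the proof uses of a Dynkin diagram, besides the bound on its weights: it is a forest, and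
  there is a superharmonic vector.\<close>

locale finite_weyl_quiver = weyl_quiver Q for Q :: "'v::finite quiver" +
  fixes f :: "'v \<Rightarrow> nat" and u :: "'v \<Rightarrow> real"
  assumes numbering: "one_lower_neighbour f Q"
    and u_pos: "0 < u i"
    and u_superharmonic: "(\<Sum>j\<in>UNIV. sqrt (edge_weight Q i j) * u j) < 2 * u i"
begin

subsection \<open>Finiteness of the set of roots\<close>

definition \<rho> :: "real^'v" where "\<rho> = (\<chi> i. u i)"

lemma \<rho>_pos: "0 < form \<rho> (e i)"
proof -
  have "form \<rho> (e i) = (\<Sum>j\<in>UNIV. (if j = i then 2 * u i else 0) - sqrt (edge_weight Q i j) * u j)"
    unfolding form_e_right \<rho>_def by (intro sum.cong) (auto simp: cartan_def edge_weight_sym)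
  also have "\<dots> = 2 * u i - (\<Sum>j\<in>UNIV. sqrt (edge_weight Q i j) * u j)"
    by (simp add: sum_subtractf)
  finally show ?thesis using u_superharmonic[of i] by simp
qed

text \<open>With \<open>x $ i = u i * z i\<close>, bound every mixed product by \<open>2 z i z j \<le> (z i)\<^sup>2 + (z j)\<^sup>2\<close>; the
  coefficients of the mixed terms are nonpositive.\<close>

lemma form_lower_bound: "(\<Sum>i\<in>UNIV. u i * (x $ i / u i)\<^sup>2 * form \<rho> (e i)) \<le> form x x"
proof -
  define z where "z i = x $ i / u i" for i
  have x: "x $ i = u i * z i" for i using u_pos[of i] by (simp add: z_def)
  let ?c = "\<lambda>i j. cartan i j * u i * u j"
  have swap: "(\<Sum>i\<in>UNIV. \<Sum>j\<in>UNIV. ?c i j * (z j)\<^sup>2) = (\<Sum>i\<in>UNIV. \<Sum>j\<in>UNIV. ?c i j * (z i)\<^sup>2)"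
    by (subst sum.swap) (simp add: cartan_sym mult_ac)
  have "(\<Sum>i\<in>UNIV. u i * (z i)\<^sup>2 * form \<rho> (e i)) = (\<Sum>i\<in>UNIV. \<Sum>j\<in>UNIV. ?c i j * (z i)\<^sup>2)"
    by (simp add: form_e_right \<rho>_def sum_distrib_left cartan_sym mult_ac)
  also have "\<dots> = (\<Sum>i\<in>UNIV. \<Sum>j\<in>UNIV. ?c i j * (((z i)\<^sup>2 + (z j)\<^sup>2) / 2))"
    using swap by (simp add: distrib_left add_divide_distrib sum.distrib flip: sum_divide_distrib)
  also have "\<dots> \<le> (\<Sum>i\<in>UNIV. \<Sum>j\<in>UNIV. ?c i j * (z i * z j))"
  proof (intro sum_mono)
    fix i j
    show "?c i j * (((z i)\<^sup>2 + (z j)\<^sup>2) / 2) \<le> ?c i j * (z i * z j)"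
    proof (cases "i = j")
      case False
      then have "cartan i j \<le> 0" by (simp add: cartan_def)
      then have "?c i j \<le> 0" using u_pos[of i] u_pos[of j]
        by (simp add: mult_nonpos_nonneg)
      moreover have "z i * z j \<le> ((z i)\<^sup>2 + (z j)\<^sup>2) / 2"
        using sum_squares_bound[of "z i" "z j"] by simp
      ultimately show ?thesis by (rule mult_left_mono_neg[rotated])
    qed (simp add: power2_eq_square)
  qed
  also have "\<dots> = form x x" by (simp add: form_def x mult_ac)
  finally show ?thesis by (simp add: z_def)
qed

lemma coordinate_bound: "u i * (x $ i / u i)\<^sup>2 * form \<rho> (e i) \<le> form x x"
proof -
  have "u i * (x $ i / u i)\<^sup>2 * form \<rho> (e i) \<le> (\<Sum>i\<in>UNIV. u i * (x $ i / u i)\<^sup>2 * form \<rho> (e i))"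
    by (rule member_le_sum) (simp_all add: less_imp_le[OF u_pos] less_imp_le[OF \<rho>_pos])
  then show ?thesis using form_lower_bound[of x] by linarith
qed

lemma form_definite:
  assumes "form x x = 0"
  shows "x = 0"
proof -
  have "x $ i = 0" for i
  proof (rule ccontr)
    assume "x $ i \<noteq> 0"
    then have "0 < u i * (x $ i / u i)\<^sup>2 * form \<rho> (e i)"
      using u_pos[of i] \<rho>_pos[of i] by simp
    then show False using coordinate_bound[of i x] assms by simp
  qed
  then show ?thesis by (simp add: vec_eq_iff)
qed

definition roots :: "(real^'v) set" where "roots = {act v (e k) | v k. True}"

lemma act_root:
  assumes "x \<in> roots"
  shows "act w x \<in> roots"
proof -
  obtain v k where "x = act v (e k)" using assms by (auto simp: roots_def)
  then have "act w x = act (w @ v) (e k)" by (simp add: act_append)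
  then show ?thesis unfolding roots_def by blast
qed

lemma simple_root: "e k \<in> roots"
  using act.simps(1)[of "e k", symmetric] unfolding roots_def by blast

lemma uminus_root:
  assumes "x \<in> roots"
  shows "- x \<in> roots"
proof -
  obtain v k where x: "x = act v (e k)" using assms by (auto simp: roots_def)
  have "- x = act (v @ [k]) (e k)" by (simp add: x act_append reflect_self act_uminus)
  then show ?thesis unfolding roots_def by blast
qed

lemma form_root: "x \<in> roots \<Longrightarrow> form x x = 2"
  by (auto simp: roots_def act_isometry)

lemma root_nonneg_or_nonpos: "x \<in> roots \<Longrightarrow> 0 \<le> x \<or> x \<le> 0"
  using act_simple_nonneg_or_nonpos by (auto simp: roots_def)

text \<open>If \<open>d\<close> symmetrizes the matrix, the lattice spanned by the vectors \<open>sqrt (d i) * e i\<close> is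
  stable under the Weyl group. A multiple of every root lies in it, and the form bounds the
  coordinates of roots.\<close>

lemma finite_roots: "finite roots"
proof -
  obtain b d where b: "skew_symmetrizable b" "Q = quiver_of_matrix b"
    and d: "\<And>i. d i > (0::int)" "\<And>i j. d i * b i j = - (d j * b j i)"
    using quiver unfolding is_quiver_def skew_symmetrizable_def by metis
  have sqrt_weight: "sqrt (edge_weight Q k i) * sqrt (d i) = \<bar>b k i\<bar> * sqrt (d k)" for k i
  proof -
    have "d i * \<bar>b i k\<bar> = d k * \<bar>b k i\<bar>"
      using d(1)[of i] d(1)[of k] arg_cong[OF d(2)[of i k], of abs] by (simp add: abs_mult)
    then have "\<bar>b k i\<bar> * (d i * \<bar>b i k\<bar>) = \<bar>b k i\<bar> * (d k * \<bar>b k i\<bar>)" by simp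
    then have "\<bar>b k i * b i k\<bar> * d i = \<bar>b k i\<bar>\<^sup>2 * d k"
      unfolding abs_mult power2_eq_square by (simp only: mult_ac)
    moreover have "int (edge_weight Q k i) = \<bar>b k i * b i k\<bar>"
      unfolding b(2) edge_weight_matrix[OF b(1)] by simp
    ultimately have "int (edge_weight Q k i) * d i = \<bar>b k i\<bar>\<^sup>2 * d k" by simp
    then have "real (edge_weight Q k i) * real_of_int (d i) = (real_of_int \<bar>b k i\<bar>)\<^sup>2 * real_of_int (d k)"
      by (metis (mono_tags, lifting) of_int_mult of_int_of_nat_eq of_int_power)
    then have "sqrt (real (edge_weight Q k i) * real_of_int (d i)) = sqrt ((real_of_int \<bar>b k i\<bar>)\<^sup>2 * real_of_int (d k))"
      by simp
    then show ?thesis by (simp only: real_sqrt_mult real_sqrt_abs abs_abs of_int_abs)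
  qed
  define L where "L x \<longleftrightarrow> (\<forall>i. \<exists>n::int. x $ i = n * sqrt (d i))" for x :: "real^'v"
  have "L (reflect (e k) x)" if Lx: "L x" for x k
  proof -
    obtain n :: "'v \<Rightarrow> int" where n: "\<And>i. x $ i = n i * sqrt (d i)"
      using Lx unfolding L_def by metis
    have "x $ i * cartan i k = (if i = k then 2 * n i else - (n i * \<bar>b k i\<bar>)) * sqrt (d k)" for i
      using sqrt_weight[of k i] by (simp add: n cartan_def edge_weight_sym[of i k] mult_ac)
    then have "form x (e k) = (\<Sum>i\<in>UNIV. (if i = k then 2 * n i else - (n i * \<bar>b k i\<bar>))) * sqrt (d k)"
      unfolding form_e_right by (simp add: sum_distrib_right)
    then obtain m :: int where m: "form x (e k) = m * sqrt (d k)" by blast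
    have "reflect (e k) x $ i = (if i = k then n i - m else n i) * sqrt (d i)" for i
      by (simp add: reflect_def m n e_nth_mult algebra_simps)
    then show ?thesis unfolding L_def by blast
  qed
  then have L_act: "L (act v x)" if "L x" for v x
    using that by (induction v) auto
  have "L (sqrt (d k) *\<^sub>R e k)" for k
    unfolding L_def
  proof
    fix i show "\<exists>n::int. (sqrt (d k) *\<^sub>R e k) $ i = n * sqrt (d i)"
      by (intro exI[of _ "if i = k then 1 else 0"]) (simp add: e_nth_mult)
  qed
  then have L_root: "L (sqrt (d k) *\<^sub>R act v (e k))" for v k
    using L_act by (simp flip: act_scale)
  \<comment> \<open>\<open>C k i\<close> bounds the square of the \<open>i\<close>-th lattice coordinate of a root in the orbit of \<open>e k\<close>.\<close>
  define C where "C k i = d k * 2 * u i / form \<rho> (e i)" for k i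
  define S where "S k i = {n::int. (real_of_int n)\<^sup>2 \<le> C k i}" for k i
  have fin: "finite (S k i)" for k i
  proof (rule finite_subset)
    show "S k i \<subseteq> {- \<lceil>C k i\<rceil> .. \<lceil>C k i\<rceil>}"
    proof
      fix n assume "n \<in> S k i"
      then have "real_of_int (n\<^sup>2) \<le> C k i" by (simp add: S_def)
      then have "n\<^sup>2 \<le> \<lceil>C k i\<rceil>" by linarith
      moreover have "\<bar>n\<bar> \<le> n\<^sup>2"
        using mult_left_mono[of 1 "\<bar>n\<bar>" "\<bar>n\<bar>"] by (cases "n = 0") (auto simp: power2_eq_square)
      ultimately show "n \<in> {- \<lceil>C k i\<rceil> .. \<lceil>C k i\<rceil>}" by auto
    qed
  qed simp
  have "roots \<subseteq> (\<Union>k. (\<lambda>n. \<chi> i. n i * sqrt (d i) / sqrt (d k)) ` (\<Pi>\<^sub>E i\<in>UNIV. S k i))"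
  proof
    fix x assume x: "x \<in> roots"
    then obtain v k where "x = act v (e k)" by (auto simp: roots_def)
    then have "L (sqrt (d k) *\<^sub>R x)" using L_root by simp
    then obtain n :: "'v \<Rightarrow> int" where n: "\<And>i. sqrt (d k) * x $ i = n i * sqrt (d i)"
      unfolding L_def by (metis vector_scaleR_component real_scaleR_def)
    have "x = (\<chi> i. n i * sqrt (d i) / sqrt (d k))"
      using d(1)[of k] by (simp add: vec_eq_iff flip: n)
    moreover have "n i \<in> S k i" for i
    proof -
      have di: "1 \<le> real_of_int (d i)" using d(1)[of i] by simp
      have "(n i)\<^sup>2 \<le> (n i)\<^sup>2 * real_of_int (d i)"
        using mult_left_mono[OF di, of "(n i)\<^sup>2"] by simp
      also have "\<dots> = (n i * sqrt (d i))\<^sup>2" using d(1)[of i] by (simp add: power_mult_distrib)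
      also have "\<dots> = d k * (x $ i)\<^sup>2" using d(1)[of k] by (simp add: power_mult_distrib flip: n)
      also have "(x $ i)\<^sup>2 \<le> 2 * u i / form \<rho> (e i)"
        using coordinate_bound[of i x] form_root[OF x] u_pos[of i] \<rho>_pos[of i]
        by (simp add: field_simps power2_eq_square)
      then have "d k * (x $ i)\<^sup>2 \<le> d k * (2 * u i / form \<rho> (e i))"
        using d(1)[of k] by (intro mult_left_mono) auto
      finally show ?thesis by (simp add: S_def C_def)
    qed
    ultimately show "x \<in> (\<Union>k. (\<lambda>n. \<chi> i. n i * sqrt (d i) / sqrt (d k)) ` (\<Pi>\<^sub>E i\<in>UNIV. S k i))"
      by auto
  qed
  then show ?thesis
    by (rule finite_subset) (intro finite_UN_I finite_imageI finite_PiE fin; simp)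
qed

end

subsection \<open>Signs along a tree\<close>

text \<open>Treat the vertices in the order of their numbers. The sign at a new vertex is dictated by its
  only earlier neighbour, and does not matter for the other earlier vertices.\<close>

lemma tree_sign_choice:
  fixes Q :: "'v::finite quiver" and C :: "'v \<Rightarrow> 'v \<Rightarrow> real"
  assumes f: "one_lower_neighbour f Q"
    and C_sym: "\<And>i j. C i j = C j i"
    and C_sq: "\<And>i j. i \<noteq> j \<Longrightarrow> (C i j)\<^sup>2 = edge_weight Q i j"
  obtains \<epsilon> where "\<And>i. \<epsilon> i = 1 \<or> \<epsilon> i = (- 1 :: real)"
    and "\<And>i j. i \<noteq> j \<Longrightarrow> \<epsilon> i * \<epsilon> j * C i j = - sqrt (edge_weight Q i j)"
proof -
  have wsym: "edge_weight Q i j = edge_weight Q j i" for i j by (simp add: edge_weight_def)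
  have sqrt_C: "sqrt (edge_weight Q i j) = \<bar>C i j\<bar>" if "i \<noteq> j" for i j
    using C_sq[OF that] by (metis real_sqrt_abs)
  have "\<exists>\<epsilon>. (\<forall>i. \<epsilon> i = 1 \<or> \<epsilon> i = (- 1 :: real)) \<and>
      (\<forall>i j. i \<noteq> j \<and> f i < m \<and> f j < m \<longrightarrow> \<epsilon> i * \<epsilon> j * C i j = - \<bar>C i j\<bar>)" for m
  proof (induction m)
    case 0
    show ?case by (intro exI[of _ "\<lambda>_. 1"]) simp
  next
    case (Suc m)
    then obtain \<epsilon> where \<epsilon>: "\<And>i. \<epsilon> i = 1 \<or> \<epsilon> i = (- 1 :: real)"
      "\<And>i j. \<lbrakk>i \<noteq> j; f i < m; f j < m\<rbrakk> \<Longrightarrow> \<epsilon> i * \<epsilon> j * C i j = - \<bar>C i j\<bar>" by blast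
    show ?case
    proof (cases "\<exists>c a. f c = m \<and> f a < m \<and> edge_weight Q a c > 0")
      case False
      have "\<epsilon> i * \<epsilon> j * C i j = - \<bar>C i j\<bar>" if "i \<noteq> j" "f i < Suc m" "f j < Suc m" for i j
      proof (cases "f i < m \<and> f j < m")
        case True
        then show ?thesis using \<epsilon>(2) that(1) by blast
      next
        case notless: False
        have "f i \<noteq> f j" using f that(1) by (auto simp: one_lower_neighbour_def inj_def)
        then have "f i = m \<and> f j < m \<or> f j = m \<and> f i < m" using notless that by auto
        then have "edge_weight Q i j = 0" using False wsym by (metis gr0I)
        then have "C i j = 0" using C_sq[OF that(1)] by simp
        then show ?thesis by simp
      qed
      then show ?thesis using \<epsilon>(1) by blast
    next
      case True
      then obtain c a where ca: "f c = m" "f a < m" "edge_weight Q a c > 0" by blast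
      define \<epsilon>' where "\<epsilon>' = \<epsilon>(c := (if C a c > 0 then - \<epsilon> a else \<epsilon> a))"
      have sgn: "\<epsilon>' i = 1 \<or> \<epsilon>' i = - 1" for i using \<epsilon>(1)[of i] \<epsilon>(1)[of a] by (auto simp: \<epsilon>'_def)
      have new: "\<epsilon>' b * \<epsilon>' c * C b c = - \<bar>C b c\<bar>" if "f b < m" for b
      proof (cases "b = a")
        case True
        have "a \<noteq> c" using ca by auto
        moreover have "\<epsilon> a * \<epsilon> a = 1" using \<epsilon>(1)[of a] by auto
        ultimately show ?thesis using True by (auto simp: \<epsilon>'_def)
      next
        case False
        then have "\<not> edge_weight Q b c > 0"
          using f ca that unfolding one_lower_neighbour_def by metis
        moreover have "b \<noteq> c" using ca that by auto
        ultimately have "C b c = 0" using C_sq[of b c] by simp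
        then show ?thesis by simp
      qed
      have "\<epsilon>' i * \<epsilon>' j * C i j = - \<bar>C i j\<bar>" if ij: "i \<noteq> j" "f i < Suc m" "f j < Suc m" for i j
      proof -
        have "f i \<noteq> f j" using f ij(1) by (auto simp: one_lower_neighbour_def inj_def)
        then consider "f i < m" "f j < m" | "f i < m" "f j = m" | "f j < m" "f i = m"
          using ij by linarith
        then show ?thesis
        proof cases
          case 1
          then have "i \<noteq> c" "j \<noteq> c" using ca by auto
          then show ?thesis using \<epsilon>(2)[OF ij(1) 1] by (simp add: \<epsilon>'_def)
        next
          case 2
          then have "j = c" using f ca by (auto simp: one_lower_neighbour_def inj_def)
          then show ?thesis using new[OF 2(1)] by simp
        next
          case 3
          then have "i = c" using f ca by (auto simp: one_lower_neighbour_def inj_def)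
          then show ?thesis using new[OF 3(1)] C_sym[of c j] by (simp add: mult_ac)
        qed
      qed
      then show ?thesis using sgn by blast
    qed
  qed
  from this[of "Suc (Max (range f))"] obtain \<epsilon> where \<epsilon>: "\<And>i. \<epsilon> i = 1 \<or> \<epsilon> i = (- 1 :: real)"
    and *: "\<And>i j. i \<noteq> j \<and> f i < Suc (Max (range f)) \<and> f j < Suc (Max (range f)) \<Longrightarrow>
      \<epsilon> i * \<epsilon> j * C i j = - \<bar>C i j\<bar>" by blast
  have "f i < Suc (Max (range f))" for i by (simp add: less_Suc_eq_le)
  with * have "\<epsilon> i * \<epsilon> j * C i j = - sqrt (edge_weight Q i j)" if "i \<noteq> j" for i j
    using that by (simp add: sqrt_C)
  with \<epsilon> that show thesis by blast
qed

context finite_weyl_quiver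
begin

subsection \<open>An isometry permuting the roots is simple up to the Weyl group\<close>

text \<open>Choose \<open>w\<close> such that \<open>w (g \<rho>)\<close> is as close to \<open>\<rho>\<close> as possible. Then \<open>h = w g\<close>
  maps \<open>\<rho>\<close> into the closed fundamental chamber, so the preimages under \<open>h\<close> of the simple roots are
  positive roots. Hence \<open>h\<close> permutes the simple roots, as these are the indecomposable positive
  roots.\<close>

theorem isometry_simple_up_to_weyl:
  assumes g: "linear g" "\<And>x y. form (g x) (g y) = form x y" "\<And>x. x \<in> roots \<Longrightarrow> g x \<in> roots"
  shows "\<exists>w. \<forall>i. \<exists>j. act w (g (e i)) = e j"
proof -
  let ?F = "\<lambda>w. form \<rho> (act w (g \<rho>))"
  have "?F w = (\<Sum>i\<in>UNIV. u i * form \<rho> (act w (g (e i))))" for w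
  proof -
    have "g \<rho> = (\<Sum>i\<in>UNIV. u i *\<^sub>R g (e i))"
      by (subst vec_expansion[of \<rho>]) (simp add: linear_sum[OF g(1)] linear_cmul[OF g(1)] \<rho>_def)
    then show ?thesis by (simp add: act_sum act_scale form_sum_right form_scale_right)
  qed
  then have "range ?F \<subseteq> (\<lambda>r. \<Sum>i\<in>UNIV. u i * form \<rho> (r i)) ` (\<Pi>\<^sub>E i\<in>UNIV. roots)"
    using act_root g(3) simple_root by (auto intro!: image_eqI[of _ _ "\<lambda>i. act w (g (e i))" for w])
  then have fin: "finite (range ?F)"
    by (rule finite_subset) (intro finite_imageI finite_PiE finite_roots, simp)
  obtain w where "?F w = Max (range ?F)" using Max_in[OF fin] by auto
  then have max: "?F w' \<le> ?F w" for w' using fin by simp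
  define h where "h x = act w (g x)" for x
  have h_linear: "linear h"
    unfolding h_def by (rule linearI) (simp_all add: linear_add[OF g(1)] linear_cmul[OF g(1)] act_add act_scale)
  have h_isometry: "form (h x) (h y) = form x y" for x y by (simp add: h_def act_isometry g(2))
  have h_root: "h x \<in> roots" if "x \<in> roots" for x unfolding h_def by (intro act_root g(3) that)
  have h_inj: "x = y" if "h x = h y" for x y
    using that h_isometry[of "x - y" "x - y"] form_definite[of "x - y"] by (simp add: linear_diff[OF h_linear])
  have chamber: "0 \<le> form (h \<rho>) (e j)" for j
  proof -
    have "form \<rho> (reflect (e j) (h \<rho>)) \<le> form \<rho> (h \<rho>)" using max[of "j # w"] by (simp add: h_def)
    then have "0 \<le> form (h \<rho>) (e j) * form \<rho> (e j)" by (simp add: reflect_def form_simps)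
    then show ?thesis using \<rho>_pos[of j] by (simp add: zero_le_mult_iff)
  qed
  have nonzero: "r \<noteq> 0" if "r \<in> roots" for r using form_root[OF that] by auto
  have preimage: "\<exists>r\<in>roots. 0 \<le> r \<and> h r = e j" for j
  proof -
    have "h ` roots = roots"
      using h_root h_inj by (intro endo_inj_surj finite_roots) (auto intro: inj_onI)
    then obtain r where r: "r \<in> roots" "h r = e j" using simple_root[of j] by (metis imageE)
    have "0 \<le> r"
    proof (rule ccontr)
      assume "\<not> 0 \<le> r"
      then have r_le: "r $ i \<le> 0" for i using root_nonneg_or_nonpos[OF r(1)] by (auto simp: less_eq_vec_def)
      obtain k where "r $ k \<noteq> 0" using nonzero[OF r(1)] by (auto simp: vec_eq_iff)
      then have "r $ k < 0" using r_le[of k] by simp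
      then have "(\<Sum>i\<in>UNIV. r $ i * form \<rho> (e i)) < (\<Sum>i\<in>(UNIV :: 'v set). 0)"
        using r_le \<rho>_pos by (intro sum_strict_mono_ex1) (auto simp: mult_nonpos_nonneg less_imp_le intro!: mult_neg_pos)
      then have "form \<rho> r < 0" by (simp flip: form_expand_right)
      then show False using chamber[of j] h_isometry[of \<rho> r] r(2) by simp
    qed
    with r show ?thesis by blast
  qed
  then obtain r where r: "\<And>j. r j \<in> roots" "\<And>j. 0 \<le> r j" "\<And>j. h (r j) = e j" by metis
  have "\<exists>j. h (e i) = e j" for i
  proof -
    \<comment> \<open>Write \<open>e i\<close> as a nonnegative combination of the positive vectors \<open>r j\<close>: all those that occur
      must be multiples of \<open>e i\<close>.\<close>
    define x where "x = h (e i)"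
    have "h (\<Sum>j\<in>UNIV. x $ j *\<^sub>R r j) = h (e i)"
      using vec_expansion[of x] by (simp add: linear_sum[OF h_linear] linear_cmul[OF h_linear] r(3) x_def)
    then have expansion: "e i = (\<Sum>j\<in>UNIV. x $ j *\<^sub>R r j)" using h_inj by metis
    have x_root: "x \<in> roots" unfolding x_def by (intro h_root simple_root)
    have nth: "e i $ m = (\<Sum>j\<in>UNIV. x $ j * r j $ m)" for m
      by (subst expansion) simp
    have r_nonneg: "0 \<le> r j $ m" for j m using r(2)[of j] by (simp add: less_eq_vec_def)
    have "0 \<le> x"
    proof (rule ccontr)
      assume "\<not> 0 \<le> x"
      then have "x $ j \<le> 0" for j using root_nonneg_or_nonpos[OF x_root] by (auto simp: less_eq_vec_def)
      then have "e i $ i \<le> 0"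
        unfolding nth[of i] by (intro sum_nonpos mult_nonpos_nonneg r_nonneg)
      then show False by simp
    qed
    then have x_nonneg: "0 \<le> x $ j" for j by (simp add: less_eq_vec_def)
    obtain j where j: "x $ j \<noteq> 0" using nonzero[OF x_root] by (auto simp: vec_eq_iff)
    have "r j $ m = 0" if "m \<noteq> i" for m
    proof -
      have "(\<Sum>j\<in>UNIV. x $ j * r j $ m) = 0" using nth[of m] that by (simp add: axis_def)
      then have "x $ j * r j $ m = 0"
        using x_nonneg r_nonneg by (subst (asm) sum_nonneg_eq_0_iff) auto
      then show ?thesis using j by simp
    qed
    then have ri: "r j = (r j $ i) *\<^sub>R e i" by (auto simp: vec_eq_iff axis_def)
    have "form (r j) (r j) = 2 * (r j $ i)\<^sup>2"
      by (subst (1 2) ri) (simp add: form_simps power2_eq_square)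
    then have "(r j $ i)\<^sup>2 = 1" using form_root[OF r(1)[of j]] by simp
    then have "r j $ i = 1" using r_nonneg[of j i] by (auto simp: power2_eq_1_iff)
    then have "r j = e i" using ri by simp
    then show ?thesis using r(3)[of j] by auto
  qed
  then show ?thesis unfolding h_def by blast
qed

end

context finite_weyl_quiver
begin

lemma e_eq_or_uminus: "e i = e j \<or> e i = - e j \<Longrightarrow> i = j"
proof (rule ccontr)
  assume "e i = e j \<or> e i = - e j" "i \<noteq> j"
  then have "e i $ i = e j $ i \<or> e i $ i = - e j $ i" by (metis vector_uminus_component)
  with \<open>i \<noteq> j\<close> show False by (simp add: axis_def)
qed

text \<open>The order of the product of two reflections in roots \<open>b\<close>, \<open>c\<close> determines \<open>(form b c)\<^sup>2\<close>, so
  the images of the simple reflections have up to sign the same mutual position as the simple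
  roots. The signs can be chosen consistently on a tree, which gives an isometry \<open>g\<close> inducing \<open>\<alpha>\<close>.\<close>

theorem reflection_preserving_auto:
  assumes \<alpha>: "\<alpha> \<in> hom (weyl_group Q) (weyl_group Q)" "inj_on \<alpha> (carrier (weyl_group Q))"
    and refl: "\<And>i. \<alpha> (simple_reflection Q i) \<in> reflections Q"
  obtains w \<pi> where "bij \<pi>" "\<And>i j. edge_weight Q (\<pi> i) (\<pi> j) = edge_weight Q i j"
    "\<And>i. \<alpha> (simple_reflection Q i) = elt (w @ [\<pi> i] @ rev w)"
proof -
  have "\<exists>v k. \<alpha> (elt [i]) = elt (v @ [k] @ rev v)" for i
    using refl[of i] unfolding reflections_elt simple_reflection_elt by auto
  then obtain v k where vk: "\<And>i. \<alpha> (elt [i]) = elt (v i @ [k i] @ rev (v i))" by metis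
  define \<beta> where "\<beta> i = act (v i) (e (k i))" for i
  define A where "A w = concat (map (\<lambda>i. v i @ [k i] @ rev (v i)) w)" for w
  have A_append: "A (x @ y) = A x @ A y" for x y by (simp add: A_def)
  have \<alpha>_elt: "\<alpha> (elt w) = elt (A w)" for w
  proof (induction w)
    case Nil
    show ?case using hom_one[OF \<alpha>(1) W.is_group W.is_group] by (simp add: A_def one_elt)
  next
    case (Cons i w)
    have "\<alpha> (elt (i # w)) = \<alpha> (elt [i]) \<otimes>\<^bsub>weyl_group Q\<^esub> \<alpha> (elt w)"
      using elt_append[of "[i]" w] hom_mult[OF \<alpha>(1)] by simp
    then show ?case using Cons vk by (simp add: A_def flip: elt_append)
  qed
  have act_A: "act (A (i # w)) x = reflect (\<beta> i) (act (A w) x)" for i w x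
    using act_reflection[of "v i" "k i" "act (A w) x"] by (simp add: A_def \<beta>_def act_append)
  have act_A_Nil: "act (A []) x = x" for x by (simp add: A_def)
  \<comment> \<open>As \<open>\<alpha>\<close> is injective and the action is faithful, the simple reflections and their images
    satisfy the same relations.\<close>
  have transfer: "(\<forall>x. act (A w) x = act (A w') x) \<longleftrightarrow> (\<forall>x. act w x = act w' x)" for w w'
  proof
    assume "\<forall>x. act (A w) x = act (A w') x"
    then have "elt (A w) = elt (A w')" by (intro elt_eqI) blast
    then have "\<alpha> (elt w) = \<alpha> (elt w')" by (simp add: \<alpha>_elt)
    then have "elt w = elt w'" using \<alpha>(2) by (simp add: inj_on_eq_iff)
    then show "\<forall>x. act w x = act w' x" using act_cong by blast
  next
    assume "\<forall>x. act w x = act w' x"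
    then have "elt w = elt w'" by (intro elt_eqI) blast
    then have "elt (A w) = elt (A w')" by (simp flip: \<alpha>_elt)
    then show "\<forall>x. act (A w) x = act (A w') x" using act_cong by blast
  qed
  have \<beta>_root: "\<beta> i \<in> roots" for i unfolding \<beta>_def by (intro act_root simple_root)
  have norm: "form (\<beta> i) (\<beta> i) = 2" for i by (rule form_root[OF \<beta>_root])
  have independent: "\<not> (\<beta> i = \<beta> j \<or> \<beta> i = - \<beta> j)" if "i \<noteq> j" for i j
  proof
    assume "\<beta> i = \<beta> j \<or> \<beta> i = - \<beta> j"
    then have "reflect (\<beta> i) = reflect (\<beta> j)" using reflect_uminus by metis
    then have "\<forall>x. act (A [i]) x = act (A [j]) x" by (simp add: act_A act_A_Nil)
    then have "reflect (e i) = reflect (e j)" unfolding transfer by (simp add: fun_eq_iff)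
    then show False using reflect_eq_imp[of "e i" "e j"] e_eq_or_uminus that by auto
  qed
  have commute: "(form (\<beta> i) (\<beta> j) = 0) = (edge_weight Q i j = 0)" if "i \<noteq> j" for i j
  proof -
    have "(form (\<beta> i) (\<beta> j) = 0) = (\<forall>x. act (A [i, j]) x = act (A [j, i]) x)"
      using reflect_commute[of "\<beta> i" "\<beta> j"] reflect_commute_imp[OF norm norm, of i j] independent[OF that]
      by (auto simp: act_A act_A_Nil)
    also have "\<dots> = (form (e i) (e j) = 0)"
      using reflect_commute[of "e i" "e j"] reflect_commute_imp[of "e i" "e j"] e_eq_or_uminus[of i j] that
      unfolding transfer by auto
    also have "\<dots> = (edge_weight Q i j = 0)" using that by (simp add: form_e_e cartan_def)
    finally show ?thesis .
  qed
  have form_sq: "(form (e i) (e j))\<^sup>2 = edge_weight Q i j" if "i \<noteq> j" for i j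
    using that by (simp add: form_e_e cartan_def)
  have braid: "((form (\<beta> i) (\<beta> j))\<^sup>2 = 1) = (edge_weight Q i j = 1)" if "i \<noteq> j" for i j
  proof -
    have "((form (\<beta> i) (\<beta> j))\<^sup>2 = 1) = (\<forall>x. act (A [i, j, i]) x = act (A [j, i, j]) x)"
      using reflect_braid_3[OF norm norm, of i j] reflect_braid_3_imp[OF norm norm, of i j] independent[OF that]
      by (auto simp: act_A act_A_Nil)
    also have "\<dots> = ((form (e i) (e j))\<^sup>2 = 1)"
      using reflect_braid_3[of "e i" "e j"] reflect_braid_3_imp[of "e i" "e j"] e_eq_or_uminus[of i j] that
      unfolding transfer by auto
    also have "\<dots> = (edge_weight Q i j = 1)" unfolding form_sq[OF that] by simp
    finally show ?thesis .
  qed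
  have sq: "(form (\<beta> i) (\<beta> j))\<^sup>2 = edge_weight Q i j" if "i \<noteq> j" for i j
  proof (cases i j rule: edge_weight_cases)
    case 1
    then show ?thesis using commute[OF that] by simp
  next
    case 2
    then show ?thesis using braid[OF that] by simp
  next
    case 3
    then have "\<forall>x. act [i, j, i, j] x = act [j, i, j, i] x"
      using reflect_braid_4[of "e i" "e j"] form_sq[OF that] by simp
    then have "\<forall>x. act (A [i, j, i, j]) x = act (A [j, i, j, i]) x" unfolding transfer .
    then have "(form (\<beta> i) (\<beta> j))\<^sup>2 = 2 \<or> form (\<beta> i) (\<beta> j) = 0"
      using reflect_braid_4_imp[OF norm norm, of i j] independent[OF that] by (auto simp: act_A act_A_Nil)
    then show ?thesis using commute[OF that] 3 by simp
  next
    case 4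
    then have "\<forall>x. act [i, j, i, j, i, j] x = act [j, i, j, i, j, i] x"
      using reflect_braid_6[of "e i" "e j"] form_sq[OF that] by simp
    then have "\<forall>x. act (A [i, j, i, j, i, j]) x = act (A [j, i, j, i, j, i]) x" unfolding transfer .
    then have "(form (\<beta> i) (\<beta> j))\<^sup>2 = 3 \<or> (form (\<beta> i) (\<beta> j))\<^sup>2 = 1 \<or> form (\<beta> i) (\<beta> j) = 0"
      using reflect_braid_6_imp[OF norm norm, of i j] independent[OF that] by (auto simp: act_A act_A_Nil)
    then show ?thesis using commute[OF that] braid[OF that] 4 by simp
  qed
  obtain \<epsilon> where \<epsilon>: "\<And>i. \<epsilon> i = 1 \<or> \<epsilon> i = (- 1 :: real)"
    and \<epsilon>_form: "\<And>i j. i \<noteq> j \<Longrightarrow> \<epsilon> i * \<epsilon> j * form (\<beta> i) (\<beta> j) = - sqrt (edge_weight Q i j)"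
    using tree_sign_choice[OF numbering, of "\<lambda>i j. form (\<beta> i) (\<beta> j)"] form_sym sq by metis
  define \<gamma> where "\<gamma> i = \<epsilon> i *\<^sub>R \<beta> i" for i
  have \<gamma>: "\<gamma> i = \<beta> i \<or> \<gamma> i = - \<beta> i" for i using \<epsilon>[of i] by (auto simp: \<gamma>_def)
  have \<gamma>_form: "form (\<gamma> i) (\<gamma> j) = cartan i j" for i j
    using \<epsilon>_form[of i j] \<epsilon>[of i] norm[of i] by (auto simp: \<gamma>_def form_simps cartan_def mult_ac)
  \<comment> \<open>The isometry with \<open>g (w x) = (\<alpha> w) (g x)\<close>.\<close>
  define g where "g x = (\<Sum>i\<in>UNIV. x $ i *\<^sub>R \<gamma> i)" for x :: "real^'v"
  have g_linear: "linear g"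
    unfolding g_def by (rule linearI) (simp_all add: scaleR_add_left sum.distrib scaleR_sum_right)
  have g_e: "g (e i) = \<gamma> i" for i
  proof -
    have "g (e i) = (\<Sum>j\<in>UNIV. if j = i then \<gamma> j else 0)"
      unfolding g_def by (intro sum.cong) (auto simp: axis_def)
    then show ?thesis by simp
  qed
  have g_isometry: "form (g x) (g y) = form x y" for x y
    unfolding g_def form_def[of x y] form_sum_left form_sum_right form_scale_left form_scale_right
    by (subst sum.swap) (simp add: \<gamma>_form sum_distrib_left mult_ac)
  have g_reflect: "g (reflect (e i) x) = reflect (\<beta> i) (g x)" for i x
  proof -
    have "g (reflect (e i) x) = reflect (\<gamma> i) (g x)"
      using g_isometry[of x "e i"]
      by (simp add: reflect_def linear_diff[OF g_linear] linear_cmul[OF g_linear] g_e)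
    then show ?thesis using \<gamma>[of i] reflect_uminus by metis
  qed
  have g_act: "g (act w x) = act (A w) (g x)" for w x
    by (induction w) (simp_all add: act_A act_A_Nil g_reflect)
  have "g x \<in> roots" if x: "x \<in> roots" for x
  proof -
    obtain w i where "x = act w (e i)" using x by (auto simp: roots_def)
    moreover have "\<gamma> i \<in> roots" using \<gamma>[of i] \<beta>_root[of i] uminus_root by auto
    ultimately show ?thesis by (simp add: g_act g_e act_root)
  qed
  then obtain w where "\<forall>i. \<exists>j. act w (g (e i)) = e j"
    using isometry_simple_up_to_weyl[OF g_linear g_isometry] by blast
  then obtain \<pi> where \<pi>: "\<And>i. act w (\<gamma> i) = e (\<pi> i)" unfolding g_e by metis
  have cartan_\<pi>: "cartan (\<pi> i) (\<pi> j) = cartan i j" for i j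
    using act_isometry[of w "\<gamma> i" "\<gamma> j"] by (simp add: \<pi> \<gamma>_form form_e_e)
  have "inj \<pi>"
  proof (rule injI, rule ccontr)
    fix i j assume "\<pi> i = \<pi> j" "i \<noteq> j"
    then have "2 = - sqrt (edge_weight Q i j)" using cartan_\<pi>[of i j] by (simp add: cartan_def)
    moreover have "0 \<le> sqrt (edge_weight Q i j)" by simp
    ultimately show False by linarith
  qed
  show thesis
  proof (rule that)
    show "bij \<pi>" using \<open>inj \<pi>\<close> by (simp add: bij_def finite_UNIV_inj_surj)
    show "edge_weight Q (\<pi> i) (\<pi> j) = edge_weight Q i j" for i j
      using cartan_\<pi>[of i j] \<open>inj \<pi>\<close> by (cases "i = j") (auto simp: cartan_def inj_eq)
    show "\<alpha> (simple_reflection Q i) = elt (rev w @ [\<pi> i] @ rev (rev w))" for i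
    proof -
      have "act (rev w) (e (\<pi> i)) = \<gamma> i" using act_rev_cancel[of w "\<gamma> i"] by (simp add: \<pi>)
      then have "reflect (act (rev w) (e (\<pi> i))) = reflect (\<beta> i)"
        using \<gamma>[of i] reflect_uminus by metis
      then have "act (A [i]) x = act (rev w @ [\<pi> i] @ rev (rev w)) x" for x
        unfolding act_reflection by (simp add: act_A act_A_Nil)
      then show ?thesis unfolding simple_reflection_elt \<alpha>_elt by (rule elt_eqI)
    qed
  qed
qed

end

section \<open>Inner by diagram automorphisms\<close>

context group
begin

definition conj_by :: "'a \<Rightarrow> 'a \<Rightarrow> 'a" where
  "conj_by g = (\<lambda>x\<in>carrier G. g \<otimes> x \<otimes> inv g)"

lemma conj_by_apply: "x \<in> carrier G \<Longrightarrow> conj_by g x = g \<otimes> x \<otimes> inv g"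
  by (simp add: conj_by_def)

lemma conj_by_closed [simp]: "g \<in> carrier G \<Longrightarrow> x \<in> carrier G \<Longrightarrow> conj_by g x \<in> carrier G"
  by (simp add: conj_by_apply)

lemma inv_mult_cancel: "g \<in> carrier G \<Longrightarrow> z \<in> carrier G \<Longrightarrow> inv g \<otimes> (g \<otimes> z) = z"
  by (simp flip: m_assoc)

lemma conj_by_conj_by:
  "g \<in> carrier G \<Longrightarrow> h \<in> carrier G \<Longrightarrow> x \<in> carrier G \<Longrightarrow> conj_by g (conj_by h x) = conj_by (g \<otimes> h) x"
  by (simp add: conj_by_apply inv_mult_group m_assoc)

lemma conj_by_one: "x \<in> carrier G \<Longrightarrow> conj_by \<one> x = x"
  by (simp add: conj_by_apply)

lemma conj_by_mult:
  "g \<in> carrier G \<Longrightarrow> x \<in> carrier G \<Longrightarrow> y \<in> carrier G \<Longrightarrow> conj_by g (x \<otimes> y) = conj_by g x \<otimes> conj_by g y"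
  by (simp add: conj_by_apply m_assoc inv_mult_cancel)

lemma conj_by_auto:
  assumes "g \<in> carrier G"
  shows "conj_by g \<in> auto G"
proof -
  have "bij_betw (conj_by g) (carrier G) (carrier G)"
    using assms by (intro bij_betwI[where g = "conj_by (inv g)"]) (auto simp: conj_by_conj_by conj_by_one)
  then show ?thesis
    using assms by (auto simp: auto_def hom_def Bij_def conj_by_mult) (simp add: conj_by_def)
qed

lemma auto_extensional: "\<alpha> \<in> auto G \<Longrightarrow> \<alpha> \<in> extensional (carrier G)"
  by (simp add: auto_def Bij_def)

lemma auto_closed: "\<alpha> \<in> auto G \<Longrightarrow> x \<in> carrier G \<Longrightarrow> \<alpha> x \<in> carrier G"
  by (auto simp: auto_def hom_def)

lemma auto_conj_by:
  assumes "\<alpha> \<in> auto G" "g \<in> carrier G" "x \<in> carrier G"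
  shows "\<alpha> (conj_by g x) = conj_by (\<alpha> g) (\<alpha> x)"
proof -
  interpret \<alpha>: group_hom G G \<alpha>
    using assms(1) is_group by (simp add: group_hom_def group_hom_axioms_def auto_def)
  show ?thesis using assms by (simp add: conj_by_apply)
qed

lemma AutoGroup_mult: "\<alpha> \<in> auto G \<Longrightarrow> \<beta> \<in> auto G \<Longrightarrow> \<alpha> \<otimes>\<^bsub>AutoGroup G\<^esub> \<beta> = compose (carrier G) \<alpha> \<beta>"
  by (simp add: AutoGroup_def BijGroup_def auto_def)

lemma AutoGroup_carrier: "carrier (AutoGroup G) = auto G"
  by (simp add: AutoGroup_def)

lemma auto_compose: "\<alpha> \<in> auto G \<Longrightarrow> \<beta> \<in> auto G \<Longrightarrow> compose (carrier G) \<alpha> \<beta> \<in> auto G"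
  using monoid.m_closed[OF group.is_monoid[OF AutoGroup], of \<alpha> \<beta>]
  by (simp add: AutoGroup_mult AutoGroup_carrier)

lemma inner_automorphisms_conj_by: "inner_automorphisms G = conj_by ` carrier G"
  by (auto simp: inner_automorphisms_def conj_by_def)

text \<open>The automorphisms that map \<open>S\<close> to a conjugate of \<open>S\<close> form a group.\<close>

lemma generate_inner_image_conjugate:
  assumes S: "S \<subseteq> carrier G" and D: "D \<subseteq> auto G" "\<And>\<phi>. \<phi> \<in> D \<Longrightarrow> \<phi> ` S = S"
    and "\<alpha> \<in> generate (AutoGroup G) (inner_automorphisms G \<union> D)"
  shows "\<alpha> \<in> auto G \<and> (\<exists>g\<in>carrier G. \<alpha> ` S = conj_by g ` S)"
proof -
  have "conj_by \<one> ` S = (\<lambda>x. x) ` S"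
    using S by (intro image_cong) (auto simp: conj_by_one)
  then have one_image: "conj_by \<one> ` S = S" by simp
  have base: "\<alpha> \<in> auto G \<and> (\<exists>g\<in>carrier G. \<alpha> ` S = conj_by g ` S)"
    if "\<alpha> \<in> inner_automorphisms G \<union> D" for \<alpha>
    using that
  proof
    assume "\<alpha> \<in> inner_automorphisms G"
    then obtain g where "g \<in> carrier G" "\<alpha> = conj_by g"
      unfolding inner_automorphisms_conj_by by blast
    then show ?thesis using conj_by_auto by blast
  next
    assume "\<alpha> \<in> D"
    then have "\<alpha> \<in> auto G" "\<alpha> ` S = conj_by \<one> ` S" using D one_image by auto
    then show ?thesis using one_closed by blast
  qed
  from assms(4) show ?thesis
  proof (induction rule: generate.induct)
    case one
    have "\<one>\<^bsub>AutoGroup G\<^esub> = conj_by \<one>"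
      unfolding conj_by_def by (simp add: AutoGroup_def BijGroup_def cong: restrict_cong)
    then show ?case using conj_by_auto[of \<one>] by (metis one_closed)
  next
    case (incl \<alpha>)
    then show ?case using base by blast
  next
    case (inv \<alpha>)
    then obtain g where \<alpha>: "\<alpha> \<in> auto G" and g: "g \<in> carrier G" "\<alpha> ` S = conj_by g ` S"
      using base by blast
    let ?\<beta> = "inv\<^bsub>AutoGroup G\<^esub> \<alpha>"
    have \<beta>: "?\<beta> \<in> auto G"
      using group.inv_closed[OF AutoGroup] \<alpha> by (simp add: AutoGroup_carrier)
    have "compose (carrier G) ?\<beta> \<alpha> = \<one>\<^bsub>AutoGroup G\<^esub>"
      using group.l_inv[OF AutoGroup, of \<alpha>] \<alpha> \<beta> by (simp add: AutoGroup_mult AutoGroup_carrier)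
    then have cancel: "?\<beta> (\<alpha> x) = x" if "x \<in> carrier G" for x
      using that fun_cong[of "compose (carrier G) ?\<beta> \<alpha>" _ x] by (simp add: compose_def AutoGroup_def BijGroup_def)
    let ?h = "?\<beta> g"
    have h: "?h \<in> carrier G" using auto_closed[OF \<beta> g(1)] .
    have "?\<beta> ` \<alpha> ` S = (\<lambda>x. x) ` S"
      unfolding image_image using cancel S by (intro image_cong) auto
    moreover have "?\<beta> ` conj_by g ` S = conj_by ?h ` ?\<beta> ` S"
      unfolding image_image using S g(1) by (intro image_cong HOL.refl auto_conj_by[OF \<beta>]) auto
    ultimately have "conj_by (inv ?h) ` S = conj_by (inv ?h) ` conj_by ?h ` ?\<beta> ` S" using g(2) by simp
    also have "\<dots> = (\<lambda>x. x) ` ?\<beta> ` S"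
      unfolding image_image using S h auto_closed[OF \<beta>]
      by (intro image_cong HOL.refl) (auto simp: conj_by_conj_by conj_by_one subset_iff)
    finally show ?case using \<beta> h by (intro conjI bexI[of _ "inv ?h"]) auto
  next
    case (eng \<alpha> \<beta>)
    obtain g where \<alpha>: "\<alpha> \<in> auto G" and g: "g \<in> carrier G" "\<alpha> ` S = conj_by g ` S"
      using eng.IH(1) by blast
    obtain h where \<beta>: "\<beta> \<in> auto G" and h: "h \<in> carrier G" "\<beta> ` S = conj_by h ` S"
      using eng.IH(2) by blast
    have \<alpha>h: "\<alpha> h \<in> carrier G" using auto_closed[OF \<alpha> h(1)] .
    have "compose (carrier G) \<alpha> \<beta> ` S = \<alpha> ` \<beta> ` S"
      unfolding image_image using S by (intro image_cong HOL.refl) (auto simp: compose_def)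
    also have "\<dots> = conj_by (\<alpha> h) ` \<alpha> ` S"
      unfolding h(2) image_image using S h(1) by (intro image_cong HOL.refl auto_conj_by[OF \<alpha>]) auto
    also have "\<dots> = conj_by (\<alpha> h \<otimes> g) ` S"
      unfolding g(2) image_image using S g(1) \<alpha>h by (intro image_cong HOL.refl conj_by_conj_by) auto
    finally show ?case
      using auto_compose[OF \<alpha> \<beta>] \<alpha> \<beta> \<alpha>h g(1) by (auto simp: AutoGroup_mult)
  qed
qed

end

context finite_weyl_quiver
begin

lemma conj_by_simple_reflection: "W.conj_by (elt w) (simple_reflection Q i) = elt (w @ [i] @ rev w)"
  by (simp add: W.conj_by_apply simple_reflection_elt inv_elt flip: elt_append)

lemma coxeter_exponent_eq_edge_weight:
  "edge_weight Q i j = edge_weight Q k l \<Longrightarrow> coxeter_exponent Q i j = coxeter_exponent Q k l"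
  by (simp add: coxeter_exponent_def)

text \<open>After a conjugation \<open>\<alpha>\<close> permutes the simple reflections, and this permutation preserves the
  edge weights.\<close>

lemma inner_by_diagram_if_preserves_reflections:
  assumes \<alpha>: "\<alpha> \<in> auto (weyl_group Q)" and "\<And>i. \<alpha> (simple_reflection Q i) \<in> reflections Q"
  shows "\<alpha> \<in> inner_by_diagram_automorphisms Q"
proof -
  let ?G = "weyl_group Q"
  have "\<alpha> \<in> hom ?G ?G" "inj_on \<alpha> (carrier ?G)"
    using \<alpha> by (auto simp: auto_def Bij_def bij_betw_def)
  then obtain w \<pi> where \<pi>: "bij \<pi>" "\<And>i j. edge_weight Q (\<pi> i) (\<pi> j) = edge_weight Q i j"
    and w: "\<And>i. \<alpha> (simple_reflection Q i) = elt (w @ [\<pi> i] @ rev w)"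
    using reflection_preserving_auto[of \<alpha>] assms(2) by metis
  let ?g = "elt w"
  define \<phi> where "\<phi> = compose (carrier ?G) (W.conj_by (inv\<^bsub>?G\<^esub> ?g)) \<alpha>"
  have inner: "W.conj_by ?g \<in> auto ?G" by (simp add: W.conj_by_auto)
  have \<phi>: "\<phi> \<in> auto ?G" unfolding \<phi>_def by (intro W.auto_compose W.conj_by_auto \<alpha>) simp
  have closed: "simple_reflection Q i \<in> carrier ?G" for i by (simp add: simple_reflection_elt)
  have "\<alpha> (simple_reflection Q i) = W.conj_by ?g (simple_reflection Q (\<pi> i))" for i
    by (simp only: w conj_by_simple_reflection)
  then have "\<phi> (simple_reflection Q i) = simple_reflection Q (\<pi> i)" for i
    by (simp add: \<phi>_def compose_def closed W.conj_by_conj_by W.conj_by_one)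
  then have "\<phi> \<in> diagram_automorphisms Q"
    unfolding diagram_automorphisms_def using \<phi> \<pi> coxeter_exponent_eq_edge_weight by blast
  moreover have "W.conj_by ?g \<in> inner_automorphisms ?G"
    unfolding W.inner_automorphisms_conj_by by simp
  moreover have "\<alpha> = compose (carrier ?G) (W.conj_by ?g) \<phi>"
  proof (rule extensionalityI[of _ "carrier ?G"])
    show "\<alpha> x = compose (carrier ?G) (W.conj_by ?g) \<phi> x" if "x \<in> carrier ?G" for x
      using that W.auto_closed[OF \<alpha> that] by (simp add: compose_def \<phi>_def W.conj_by_conj_by W.conj_by_one)
  qed (use W.auto_extensional[OF \<alpha>] in \<open>auto simp: compose_def\<close>)
  ultimately show ?thesis
    unfolding inner_by_diagram_automorphisms_def
    using generate.eng[OF generate.incl generate.incl, of "W.conj_by ?g" "inner_automorphisms ?G \<union> diagram_automorphisms Q" \<phi>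
        "AutoGroup ?G"] by (simp add: W.AutoGroup_mult inner \<phi>)
qed

lemma inner_by_diagram_image_conjugate:
  assumes "\<alpha> \<in> inner_by_diagram_automorphisms Q"
  obtains w where "\<alpha> ` simple_reflections Q = range (\<lambda>i. elt (w @ [i] @ rev w))"
proof -
  have "\<phi> ` simple_reflections Q = simple_reflections Q" if \<phi>: "\<phi> \<in> diagram_automorphisms Q" for \<phi>
  proof -
    obtain \<pi> where "bij \<pi>" "\<And>i. \<phi> (simple_reflection Q i) = simple_reflection Q (\<pi> i)"
      using \<phi> by (auto simp: diagram_automorphisms_def)
    then show ?thesis unfolding simple_reflections_def image_image
      by (metis (mono_tags, lifting) bij_is_surj image_cong image_image)
  qed
  moreover have "simple_reflections Q \<subseteq> carrier (weyl_group Q)"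
    by (auto simp: simple_reflections_def simple_reflection_elt)
  ultimately obtain g where "g \<in> carrier (weyl_group Q)"
    "\<alpha> ` simple_reflections Q = W.conj_by g ` simple_reflections Q"
    using W.generate_inner_image_conjugate[of "simple_reflections Q" "diagram_automorphisms Q" \<alpha>] assms
    unfolding inner_by_diagram_automorphisms_def diagram_automorphisms_def by auto
  moreover from this obtain w where "g = elt w" by (auto simp: carrier_elt)
  ultimately have "\<alpha> ` simple_reflections Q = range (\<lambda>i. elt (w @ [i] @ rev w))"
    by (simp add: simple_reflections_def image_image conj_by_simple_reflection)
  then show thesis by (rule that)
qed

end

lemma finite_weyl_quiver_dynkin:
  fixes Q :: "'v::finite quiver"
  assumes "is_dynkin \<Gamma>" "dynkin_quiver \<Gamma> Q"
  shows "\<exists>f u. finite_weyl_quiver Q f u"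
proof -
  obtain f where f: "bij_betw f (UNIV :: 'v set) {..<dynkin_rank \<Gamma>}"
    and w: "\<And>i j. edge_weight Q i j = dynkin_edge \<Gamma> (f i) (f j)"
    using assms(2) by (auto simp: dynkin_quiver_def)
  obtain u where u: "superharmonic_weights \<Gamma> u" using superharmonic_weights_exist[OF assms(1)] by blast
  have f_less: "f i < dynkin_rank \<Gamma>" for i using f by (auto simp: bij_betw_def)
  have "(\<Sum>j\<in>UNIV. sqrt (edge_weight Q i j) * u (f j)) = (\<Sum>j<dynkin_rank \<Gamma>. sqrt (dynkin_edge \<Gamma> (f i) j) * u j)" for i
    unfolding w by (rule sum.reindex_bij_betw[OF f])
  then have "(\<Sum>j\<in>UNIV. sqrt (edge_weight Q i j) * u (f j)) < 2 * u (f i)" "0 < u (f i)" for i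
    using u f_less[of i] by (simp_all add: superharmonic_weights_def)
  moreover have "one_lower_neighbour f Q"
    using f dynkin_edge_lower_neighbour[OF assms(1)] injD[of f]
    unfolding one_lower_neighbour_def bij_betw_def w by metis
  moreover have "is_quiver Q" using assms(2) by (simp add: dynkin_quiver_def)
  moreover have "edge_weight Q i j \<le> 3" for i j by (simp add: w dynkin_edge_le_3)
  ultimately have "finite_weyl_quiver Q f (\<lambda>i. u (f i))"
    by (intro finite_weyl_quiver.intro weyl_quiver.intro finite_weyl_quiver_axioms.intro)
  then show ?thesis by blast
qed

theorem theorem3p5:
  fixes \<Gamma> :: dynkin_type and Q :: "'v::finite quiver"
  assumes "is_dynkin \<Gamma>" and "dynkin_quiver \<Gamma> Q"
  shows "(\<forall>\<alpha> \<in> auto (weyl_group Q).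
            \<alpha> \<in> inner_by_diagram_automorphisms Q \<longleftrightarrow>
            (\<exists>ks Q' x'.
               mutation_seq (weyl_group Q) ks Q (simple_reflection Q) Q' x' \<and>
               same_diagram Q Q' \<and>
               range x' = \<alpha> ` simple_reflections Q)) \<and>
         (\<forall>t \<in> reflections Q.
            \<exists>ks Q' x'.
               mutation_seq (weyl_group Q) ks Q (simple_reflection Q) Q' x' \<and>
               t \<in> range x')"
proof -
  obtain f u where "finite_weyl_quiver Q f u" using finite_weyl_quiver_dynkin[OF assms] by blast
  then interpret finite_weyl_quiver Q f u .
  show ?thesis
  proof (intro conjI ballI iffI)
    fix \<alpha> assume "\<alpha> \<in> inner_by_diagram_automorphisms Q"
    then obtain w where w: "\<alpha> ` simple_reflections Q = range (\<lambda>i. elt (w @ [i] @ rev w))"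
      by (rule inner_by_diagram_image_conjugate)
    obtain ks Q' where seq: "mutation_seq (weyl_group Q) ks Q (simple_reflection Q) Q' (\<lambda>i. elt (w @ [i] @ rev w))"
      and "edge_weight Q' = edge_weight Q"
      using mutation_seq_conjugation[OF numbering, of w] by blast
    then have "same_diagram Q Q'"
      unfolding same_diagram_def by (intro exI[of _ id]) simp
    with seq w show "\<exists>ks Q' x'. mutation_seq (weyl_group Q) ks Q (simple_reflection Q) Q' x' \<and>
        same_diagram Q Q' \<and> range x' = \<alpha> ` simple_reflections Q"
      by (intro exI conjI) (assumption, assumption, simp)
  next
    fix \<alpha> assume \<alpha>: "\<alpha> \<in> auto (weyl_group Q)"
    assume "\<exists>ks Q' x'. mutation_seq (weyl_group Q) ks Q (simple_reflection Q) Q' x' \<and>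
        same_diagram Q Q' \<and> range x' = \<alpha> ` simple_reflections Q"
    then obtain ks Q' x' where seq: "mutation_seq (weyl_group Q) ks Q (simple_reflection Q) Q' x'"
      and range: "range x' = \<alpha> ` simple_reflections Q" by (elim exE conjE) (rule that)
    have "simple_reflection Q i \<in> reflections Q" for i
      unfolding reflections_elt simple_reflection_elt by (intro CollectI exI[of _ "[]"] exI[of _ i]) simp
    then have "x' i \<in> reflections Q" for i by (rule attached_elements_reflections[OF seq])
    then have "range x' \<subseteq> reflections Q" by blast
    moreover have "\<alpha> (simple_reflection Q i) \<in> range x'" for i
      unfolding range simple_reflections_def by blast
    ultimately have "\<alpha> (simple_reflection Q i) \<in> reflections Q" for i by blast
    then show "\<alpha> \<in> inner_by_diagram_automorphisms Q"
      by (rule inner_by_diagram_if_preserves_reflections[OF \<alpha>])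
  next
    fix t assume "t \<in> reflections Q"
    then obtain w i where t: "t = elt (w @ [i] @ rev w)" unfolding reflections_elt by blast
    show "\<exists>ks Q' x'. mutation_seq (weyl_group Q) ks Q (simple_reflection Q) Q' x' \<and> t \<in> range x'"
      using mutation_seq_conjugation[OF numbering, of w] unfolding t by blast
  qed
qed

end
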